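(* Let $H=H_n$ be an arbitrary sequence of graphs with $|V(H_n)|\le n$, let $D=D_n\ge 1$ be integers with $D=O(1)$, and let $p=p_n\in(0,1)$ with $p=\Omega(1)$. Let $\mathbb{Q}=G(n,p)$ and let $\mathbb{P}$ be the planted-$H$ distribution. Then: (i) If $\limsup_{n\to\infty}\mathrm{Adv}^{\le D}<\infty$, then no (sequence of) polynomial(s) $f$ of degree at most $D$ achieves strong separation between $\mathbb{P}$ and $\mathbb{Q}$. (ii) If $\lim_{n\to\infty}\mathrm{Adv}^{\le D}=\infty$, then there exists $t=t_n$ with $1\le t\le D$ such that the signed star count $f_{\mathbf{K}_{1,t}}$ achieves strong separation between $\mathbb{P}$ and $\mathbb{Q}$. In particular, $\lim_{n\to\infty}\mathrm{Adv}(f_{\mathbf{K}_{1,t}})=\infty$.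
   Context: Asymptotics are as $n\to\infty$. $a_n=o(b_n)$ means $a_n/b_n\to0$ (in particular $b_n\neq 0$ for large $n$). $p=\Omega(1)$ means $\liminf_n p_n>0$; $D=O(1)$ means $D_n$ is bounded. Graphs on vertex set $[n]$ are identified with vectors $G=(G_{\{i,j\}})\in\{0,1\}^{\binom n2}$ of edge indicators. $G(n,p)$ is the Erdős–Rényi random graph. Planted subgraph detection task: under the null $\mathbb{Q}=G(n,p)$ one observes $G(n,p)$; under $\mathbb{P}$ one observes the union of $G(n,p)$ with an independent random copy of $H$, chosen uniformly among all labelled copies of $H$ in the complete graph $K_n$ (i.e. the image of $H$ under a uniformly random injection $V(H)\to[n]$). A (sequence of) polynomial(s) $f$ in the $\binom n2$ variables $G_{\{i,j\}}$ strongly separates $\mathbb{P}$ and $\mathbb{Q}$ if $\max\{\sqrt{\mathrm{Var}_{\mathbb{P}}(f)},\sqrt{\mathrm{Var}_{\mathbb{Q}}(f)}\}=o(|\mathbb{E}_{\mathbb{P}}f-\mathbb{E}_{\mathbb{Q}}f|)$. Advantage: $\mathrm{Adv}(f)=\mathbb{E}_{\mathbb{P}}[f]/\sqrt{\mathbb{E}_{\mathbb{Q}}[f^2]}$, and $\mathrm{Adv}^{\le D}=\max_f\mathrm{Adv}(f)$ over polynomials $f$ of degree at most $D$ not vanishing identically on $\{0,1\}^{\binom n2}$. For $S\subseteq\binom{[n]}{2}$, $\chi_S(G)=\prod_{\{i,j\}\in S}\frac{G_{\{i,j\}}-p}{\sqrt{p(1-p)}}$. For a graph $\mathbf{S}$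 without isolated vertices, its signed count is $f_{\mathbf{S}}(G)=\sum_{S\subseteq\binom{[n]}{2}:\,S\cong\mathbf{S}}\chi_S(G)$, where $S\cong\mathbf S$ means the graph formed by the edges $S$ is isomorphic to $\mathbf{S}$. $\mathbf{K}_{1,t}$ is the star with $t$ edges ($t$ leaves and one central vertex). *)

theory Defs
  imports "HOL-Probability.Probability" "HOL-Library.Poly_Mapping"
begin

section \<open>Simple graphs\<close>

definition pairs :: "'v set \<Rightarrow> 'v set set" where
  "pairs V = {e. e \<subseteq> V \<and> card e = 2}"

type_synonym 'v sgraph = "'v set \<times> 'v set set"

abbreviation verts :: "'v sgraph \<Rightarrow> 'v set" where "verts H \<equiv> fst H"
abbreviation edges :: "'v sgraph \<Rightarrow> 'v set set" where "edges H \<equiv> snd H"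

definition simple_graph :: "'v sgraph \<Rightarrow> bool" where
  "simple_graph H \<longleftrightarrow> finite (verts H) \<and> edges H \<subseteq> pairs (verts H)"

definition graph_iso :: "'v sgraph \<Rightarrow> 'w sgraph \<Rightarrow> bool" where
  "graph_iso A B \<longleftrightarrow>
     (\<exists>f. bij_betw f (verts A) (verts B) \<and> (\<lambda>e. f ` e) ` edges A = edges B)"

definition star :: "nat \<Rightarrow> nat sgraph" where
  "star t = ({0..t}, {{0, i} | i. i \<in> {1..t}})"

section \<open>Random graphs on the vertex set \<open>{1..n}\<close>\<close>

text \<open>A graph is its vector of edge indicators. It is a function on all sets of naturals,
  but both distributions below live on functions that are \<open>False\<close> off \<open>pairs {1..n}\<close>.\<close>

type_synonym gvec = "nat set \<Rightarrow> bool"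

definition gnp :: "nat \<Rightarrow> real \<Rightarrow> gvec pmf" where
  "gnp n p = Pi_pmf (pairs {1..n}) False (\<lambda>_. bernoulli_pmf p)"

definition planted :: "nat \<Rightarrow> real \<Rightarrow> 'v sgraph \<Rightarrow> gvec pmf" where
  "planted n p H =
     do {
       G \<leftarrow> gnp n p;
       \<sigma> \<leftarrow> pmf_of_set {\<sigma> \<in> verts H \<rightarrow>\<^sub>E {1..n}. inj_on \<sigma> (verts H)};
       return_pmf (\<lambda>e. G e \<or> e \<in> (\<lambda>d. \<sigma> ` d) ` edges H)
     }"

section \<open>Polynomials in the edge indicators\<close>

text \<open>A monomial maps each variable (a potential edge) to its exponent; a polynomial maps
  each monomial to its coefficient.\<close>

type_synonym edge_poly = "(nat set \<Rightarrow>\<^sub>0 nat) \<Rightarrow>\<^sub>0 real"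

definition poly_eval :: "edge_poly \<Rightarrow> gvec \<Rightarrow> real" where
  "poly_eval F G =
     (\<Sum>m \<in> Poly_Mapping.keys F. Poly_Mapping.lookup F m *
        (\<Prod>e \<in> Poly_Mapping.keys m. of_bool (G e) ^ Poly_Mapping.lookup m e))"

definition polys_upto :: "nat \<Rightarrow> nat \<Rightarrow> edge_poly set" where
  "polys_upto n d =
     {F. \<forall>m \<in> Poly_Mapping.keys F. Poly_Mapping.keys m \<subseteq> pairs {1..n} \<and>
           (\<Sum>e \<in> Poly_Mapping.keys m. Poly_Mapping.lookup m e) \<le> d}"

definition adv :: "nat \<Rightarrow> real \<Rightarrow> 'v sgraph \<Rightarrow> (gvec \<Rightarrow> real) \<Rightarrow> real" where
  "adv n p H f =
     measure_pmf.expectation (planted n p H) f /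
     sqrt (measure_pmf.expectation (gnp n p) (\<lambda>G. (f G)\<^sup>2))"

text \<open>The maximum of the advantage over nonvanishing polynomials, as an extended-real supremum.
  Polynomials in \<open>polys_upto n d\<close> only read the coordinates in \<open>pairs {1..n}\<close>, so
  non-vanishing may be tested on arbitrary \<open>G\<close>.\<close>

definition adv_upto :: "nat \<Rightarrow> real \<Rightarrow> 'v sgraph \<Rightarrow> nat \<Rightarrow> ereal" where
  "adv_upto n p H d =
     (SUP F \<in> {F \<in> polys_upto n d. \<exists>G. poly_eval F G \<noteq> 0}. ereal (adv n p H (poly_eval F)))"

section \<open>Strong separation\<close>

text \<open>Unlike the library's little-o, this includes that the denominator is eventually nonzero.\<close>

definition negligible_wrt :: "(nat \<Rightarrow> real) \<Rightarrow> (nat \<Rightarrow> real) \<Rightarrow> bool" where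
  "negligible_wrt a b \<longleftrightarrow>
     (\<forall>\<^sub>F n in sequentially. b n \<noteq> 0) \<and> (\<lambda>n. a n / b n) \<longlonglongrightarrow> 0"

definition strongly_separates ::
    "(nat \<Rightarrow> gvec pmf) \<Rightarrow> (nat \<Rightarrow> gvec pmf) \<Rightarrow> (nat \<Rightarrow> gvec \<Rightarrow> real) \<Rightarrow> bool" where
  "strongly_separates P Q f \<longleftrightarrow>
     negligible_wrt
       (\<lambda>n. max (sqrt (measure_pmf.variance (P n) (f n))) (sqrt (measure_pmf.variance (Q n) (f n))))
       (\<lambda>n. \<bar>measure_pmf.expectation (P n) (f n) - measure_pmf.expectation (Q n) (f n)\<bar>)"

section \<open>Signed subgraph counts\<close>

definition chi :: "real \<Rightarrow> nat set set \<Rightarrow> gvec \<Rightarrow> real" where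
  "chi p S G = (\<Prod>e \<in> S. (of_bool (G e) - p) / sqrt (p * (1 - p)))"

definition signed_count :: "nat \<Rightarrow> real \<Rightarrow> 'v sgraph \<Rightarrow> gvec \<Rightarrow> real" where
  "signed_count n p T G = (\<Sum>S | S \<subseteq> pairs {1..n} \<and> graph_iso (\<Union>S, S) T. chi p S G)"

end

theory Submission
  imports Defs
begin

text \<open>
  Write \<open>\<lambda>\<^sup>2 = (1 - p) / p\<close>, let \<open>d\<^sub>w\<close> be the degrees of \<open>H\<close>, and put
  \<open>x\<^sub>w = \<lambda> d\<^sub>w / sqrt n\<close>. The whole theorem is governed by the star moments
  \<open>Y t = (\<Sum>w. x\<^sub>w ^ t) / sqrt n\<close>: up to constants, \<open>Y t\<close> is, when large, the advantage of
  the signed count of \<open>K\<^sub>1\<^sub>,\<^sub>t\<close>.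

  Part (i) is soft. Subtracting its null mean from a separating polynomial costs no degree and
  leaves a polynomial whose advantage is the mean gap divided by the null standard deviation,
  which tends to infinity.

  For part (ii), orthonormality of the characters \<open>\<chi>\<^sub>S\<close> and Cauchy-Schwarz bound the squared
  low-degree advantage by the sum of \<open>(E\<^sub>P \<chi>\<^sub>S)\<^sup>2\<close> over \<open>|S| \<le> D\<close>, where
  \<open>E\<^sub>P \<chi>\<^sub>S = \<lambda> ^ |S| Pr(S is contained in the planted copy)\<close>. A graph without isolated vertices is
  spanned by vertex-disjoint stars (\<open>exists_spanning_star_forest\<close>). Dropping the edges outside
  these stars only increases the number of homomorphisms into \<open>H\<close>, which then factors into degree
  power sums; since \<open>\<lambda>\<close> is bounded, the dropped edges cost only a constant. Hence
  \<open>E\<^sub>P \<chi>\<^sub>S\<close> is at most a constant times \<open>M ^ D / n ^ (v / 2)\<close>, with \<open>v\<close> the number of vertices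
  of \<open>S\<close> and \<open>M\<close> the largest of \<open>1\<close> and the \<open>Y t\<close> with \<open>1 \<le> t \<le> D\<close>. There are \<open>O(n ^ v)\<close> such \<open>S\<close>, so the advantage is bounded as soon as these \<open>Y t\<close>
  are (\<open>low_degree_energy_le\<close>). An advantage that tends to infinity therefore forces the largest
  \<open>Y t\<close> to infinity, and that \<open>t\<close> is the one to use.

  It remains to see that \<open>Y t \<rightarrow> \<infinity>\<close> alone makes the signed count of \<open>K\<^sub>1\<^sub>,\<^sub>t\<close> separate. Its planted
  mean is of order \<open>n ^ ((t+1)/2) Y t\<close>, and its null variance is at most \<open>n ^ (t+1)\<close>. Given the
  position of the planted copy, the conditional mean is \<open>\<lambda> ^ t\<close> times the number of stars in \<open>H\<close>,
  the same for every position, so all planted variance comes from the null edges. Expanding that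
  variance, the stars with \<open>s < t\<close> planted edges contribute at most a multiple of \<open>n ^ t \<Sum> x\<^sub>w ^ (2 s)\<close>, and
  splitting at a threshold \<open>K \<ge> 1\<close> gives \<open>x ^ (2 s) \<le> K ^ (2 t) + x ^ (2 t) / K\<^sup>2\<close>. The total is
  of order \<open>n ^ (t+1) (K ^ (2 t) + (Y t)\<^sup>2 / K\<^sup>2)\<close> (\<open>variance_planted_signed_star_le\<close>), which is
  negligible against the squared mean when \<open>K\<close> is a small power of \<open>Y t\<close>.
\<close>

section \<open>Fourier analysis under the null distribution\<close>

text \<open>
  The value of the normalised indicator of an edge that is present. Each planted edge of a
  character contributes this factor to its planted mean.
\<close>

definition edge_signal :: "real \<Rightarrow> real" where
  "edge_signal p = sqrt ((1 - p) / p)"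

lemma edge_signal_nonneg: "0 < p \<Longrightarrow> p < 1 \<Longrightarrow> 0 \<le> edge_signal p"
  by (simp add: edge_signal_def)

lemma normalized_present_edge:
  assumes "0 < p" "p < 1"
  shows "(1 - p) / sqrt (p * (1 - p)) = edge_signal p"
proof -
  have "(1 - p) / sqrt (p * (1 - p)) = sqrt ((1-p)*(1-p)) / sqrt (p * (1 - p))"
    using assms by simp
  also have "\<dots> = sqrt (((1-p)*(1-p)) / (p * (1 - p)))"
    by (simp only: real_sqrt_divide)
  also have "((1-p)*(1-p)) / (p * (1 - p)) = (1-p)/p" using assms by simp
  finally show ?thesis by (simp add: edge_signal_def)
qed

lemma finite_pairs: "finite V \<Longrightarrow> finite (pairs V)"
  by (rule finite_subset[of _ "Pow V"]) (auto simp: pairs_def)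

lemma finite_set_pmf_Pi_bool:
  "finite A \<Longrightarrow> finite (set_pmf (Pi_pmf A False q :: ('a \<Rightarrow> bool) pmf))"
  by (rule finite_subset[OF set_Pi_pmf_subset'])
     (auto intro: finite_PiE_dflt finite_subset[OF subset_UNIV])

lemma finite_set_gnp: "finite (set_pmf (gnp n p))"
  unfolding gnp_def by (intro finite_set_pmf_Pi_bool finite_pairs) simp

lemma integrable_gnp: "integrable (measure_pmf (gnp n p)) (f :: gvec \<Rightarrow> real)"
  by (rule integrable_measure_pmf_finite[OF finite_set_gnp])

text \<open>
  The coordinates are split off one at a time, so the factors may take both signs, as those of a
  character do.
\<close>

lemma expectation_prod_bernoulli:
  fixes h :: "'a \<Rightarrow> bool \<Rightarrow> real"
  assumes "finite A" "0 \<le> p" "p \<le> 1"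
  shows "measure_pmf.expectation (Pi_pmf A False (\<lambda>_. bernoulli_pmf p)) (\<lambda>G. \<Prod>e\<in>A. h e (G e))
    = (\<Prod>e\<in>A. p * h e True + (1 - p) * h e False)"
  using assms(1)
proof induction
  case empty
  then show ?case by simp
next
  case (insert x A)
  let ?M = "Pi_pmf A False (\<lambda>_. bernoulli_pmf p)"
  have eq: "(\<Prod>e\<in>insert x A. h e ((f(x := y)) e)) = h x y * (\<Prod>e\<in>A. h e (f e))" for f y
    using insert.hyps by (auto intro!: prod.cong)
  have "measure_pmf.expectation (Pi_pmf (insert x A) False (\<lambda>_. bernoulli_pmf p))
          (\<lambda>G. \<Prod>e\<in>insert x A. h e (G e))
     = (\<Sum>y\<in>UNIV. pmf (bernoulli_pmf p) y *\<^sub>R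
          measure_pmf.expectation (map_pmf (\<lambda>f. f(x := y)) ?M) (\<lambda>G. \<Prod>e\<in>insert x A. h e (G e)))"
    unfolding Pi_pmf_insert'[OF insert.hyps] map_pmf_def[symmetric]
    by (rule pmf_expectation_bind) (auto intro!: finite_imageI finite_set_pmf_Pi_bool insert.hyps)
  also have "\<dots> = (\<Sum>y\<in>UNIV. pmf (bernoulli_pmf p) y * (h x y * (\<Prod>e\<in>A. p * h e True + (1 - p) * h e False)))"
    by (simp only: integral_map_pmf eq integral_mult_right_zero insert.IH real_scaleR_def)
  also have "\<dots> = (\<Prod>e\<in>insert x A. p * h e True + (1 - p) * h e False)"
    using insert.hyps assms(2,3) by (simp add: UNIV_bool algebra_simps)
  finally show ?case .
qed

lemma expectation_gnp_chi_mult: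
  assumes p: "0 < p" "p < 1" and S: "S \<subseteq> pairs {1..n}" and T: "T \<subseteq> pairs {1..n}"
  shows "measure_pmf.expectation (gnp n p) (\<lambda>G. chi p S G * chi p T G) = of_bool (S = T)"
proof -
  define z where "z = (\<lambda>b. (of_bool b - p) / sqrt (p * (1 - p)))"
  define h where "h = (\<lambda>e b. (if e \<in> S then z b else 1) * (if e \<in> T then z b else 1))"
  have fin: "finite (pairs {1..n})" by (simp add: finite_pairs)
  have chi: "chi p S G = (\<Prod>e\<in>pairs {1..n}. if e \<in> S then z (G e) else 1)" if "S \<subseteq> pairs {1..n}" for S G
    using that fin by (simp add: chi_def z_def prod.If_cases Int_absorb1)
  have "measure_pmf.expectation (gnp n p) (\<lambda>G. chi p S G * chi p T G)
     = measure_pmf.expectation (gnp n p) (\<lambda>G. \<Prod>e\<in>pairs {1..n}. h e (G e))"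
    by (simp add: chi[OF S] chi[OF T] h_def prod.distrib)
  also have "\<dots> = (\<Prod>e\<in>pairs {1..n}. p * h e True + (1 - p) * h e False)"
    unfolding gnp_def using fin p by (intro expectation_prod_bernoulli) auto
  also have "\<dots> = (\<Prod>e\<in>pairs {1..n}. of_bool (e \<in> S \<longleftrightarrow> e \<in> T))"
  proof (intro prod.cong refl)
    fix e
    have pos: "p * (1 - p) > 0" using p by simp
    have z1: "p * z True + (1 - p) * z False = 0"
      by (simp add: z_def)
    have "z True * z True = (1-p)\<^sup>2 / (p * (1-p))" "z False * z False = p\<^sup>2 / (p * (1-p))"
      using pos by (simp_all add: z_def power2_eq_square)
    hence z2: "p * (z True * z True) + (1 - p) * (z False * z False) = 1"
      using p by (simp add: power2_eq_square)
    show "p * h e True + (1 - p) * h e False = of_bool (e \<in> S \<longleftrightarrow> e \<in> T)"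
      using z1 z2 by (auto simp: h_def)
  qed
  also have "\<dots> = of_bool (S = T)"
  proof (cases "S = T")
    case False
    then obtain e where "e \<in> pairs {1..n}" "(e \<in> S) \<noteq> (e \<in> T)" using S T by auto
    then show ?thesis using False fin by (intro trans[OF prod_zero]) auto
  qed simp
  finally show ?thesis .
qed

lemma expectation_gnp_chi:
  assumes "0 < p" "p < 1" "S \<subseteq> pairs {1..n}"
  shows "measure_pmf.expectation (gnp n p) (chi p S) = of_bool (S = {})"
  using expectation_gnp_chi_mult[OF assms, of "{}"] by (simp add: chi_def[of p "{}"])

lemma second_moment_chi_sum:
  assumes p: "0 < p" "p < 1" and R: "\<And>i. i \<in> I \<Longrightarrow> R i \<subseteq> pairs {1..n}"
  shows "measure_pmf.expectation (gnp n p) (\<lambda>G. (\<Sum>i\<in>I. a i * chi p (R i) G)\<^sup>2) =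
    (\<Sum>i\<in>I. \<Sum>j\<in>I. a i * a j * of_bool (R i = R j))"
proof -
  have "measure_pmf.expectation (gnp n p) (\<lambda>G. (\<Sum>i\<in>I. a i * chi p (R i) G)\<^sup>2) =
     measure_pmf.expectation (gnp n p) (\<lambda>G. (\<Sum>i\<in>I. \<Sum>j\<in>I. (a i * a j) * (chi p (R i) G * chi p (R j) G)))"
    by (simp add: power2_eq_square sum_product mult_ac)
  also have "\<dots> = (\<Sum>i\<in>I. \<Sum>j\<in>I. a i * a j * of_bool (R i = R j))"
    using R by (simp add: integrable_gnp expectation_gnp_chi_mult[OF p])
  finally show ?thesis .
qed

lemma parseval_chi:
  assumes p: "0 < p" "p < 1" and "finite I" and R: "\<And>i. i \<in> I \<Longrightarrow> R i \<subseteq> pairs {1..n}" and "inj_on R I"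
  shows "measure_pmf.expectation (gnp n p) (\<lambda>G. (\<Sum>i\<in>I. a i * chi p (R i) G)\<^sup>2) = (\<Sum>i\<in>I. (a i)\<^sup>2)"
proof -
  have "(\<Sum>j\<in>I. a i * a j * of_bool (R i = R j)) = (a i)\<^sup>2" if "i \<in> I" for i
  proof -
    have "(\<Sum>j\<in>I. a i * a j * of_bool (R i = R j)) = (\<Sum>j\<in>I. if j = i then a i * a j else 0)"
      using that \<open>inj_on R I\<close> by (intro sum.cong) (auto dest: inj_onD)
    then show ?thesis using that \<open>finite I\<close> by (simp add: power2_eq_square)
  qed
  then show ?thesis by (simp add: second_moment_chi_sum[OF p R])
qed

text \<open>
  If every character is listed at most \<open>k\<close> times, then \<open>a\<^sub>i a\<^sub>j \<le> (a\<^sub>i\<^sup>2 + a\<^sub>j\<^sup>2) / 2\<close> on coinciding pairs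
  replaces the orthogonality of distinct terms. The case \<open>k = 2\<close> occurs for stars indexed by centre
  and leaves, where a single edge has two centres.
\<close>

lemma second_moment_le_multiplicity:
  assumes p: "0 < p" "p < 1" and fin: "finite I" and R: "\<And>i. i \<in> I \<Longrightarrow> R i \<subseteq> pairs {1..n}"
    and mult: "\<And>i. i \<in> I \<Longrightarrow> card {j \<in> I. R j = R i} \<le> k"
  shows "measure_pmf.expectation (gnp n p) (\<lambda>G. (\<Sum>i\<in>I. a i * chi p (R i) G)\<^sup>2) \<le> k * (\<Sum>i\<in>I. (a i)\<^sup>2)"
proof -
  have "(\<Sum>i\<in>I. \<Sum>j\<in>I. a i * a j * of_bool (R i = R j))
     \<le> (\<Sum>i\<in>I. \<Sum>j\<in>I. ((a i)\<^sup>2 + (a j)\<^sup>2) / 2 * of_bool (R i = R j))"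
    using sum_squares_bound[of "a i" "a j" for i j]
    by (intro sum_mono mult_right_mono) (auto simp: field_simps)
  also have "\<dots> = (\<Sum>i\<in>I. \<Sum>j\<in>I. (a i)\<^sup>2 / 2 * of_bool (R i = R j)) + (\<Sum>i\<in>I. \<Sum>j\<in>I. (a j)\<^sup>2 / 2 * of_bool (R i = R j))"
    by (simp add: add_divide_distrib distrib_right sum.distrib)
  also have "(\<Sum>i\<in>I. \<Sum>j\<in>I. (a j)\<^sup>2 / 2 * of_bool (R i = R j)) = (\<Sum>i\<in>I. \<Sum>j\<in>I. (a i)\<^sup>2 / 2 * of_bool (R i = R j))"
    by (subst sum.swap) (simp add: eq_commute)
  also have "(\<Sum>i\<in>I. \<Sum>j\<in>I. (a i)\<^sup>2 / 2 * of_bool (R i = R j)) = (\<Sum>i\<in>I. (a i)\<^sup>2 / 2 * card {j \<in> I. R j = R i})"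
  proof (intro sum.cong refl)
    fix i
    have "(\<Sum>j\<in>I. of_bool (R i = R j)) = real (card {j \<in> I. R j = R i})"
      using fin by (simp add: Int_def eq_commute)
    then show "(\<Sum>j\<in>I. (a i)\<^sup>2 / 2 * of_bool (R i = R j)) = (a i)\<^sup>2 / 2 * card {j \<in> I. R j = R i}"
      by (metis sum_distrib_left)
  qed
  also have "\<dots> + \<dots> = (\<Sum>i\<in>I. (a i)\<^sup>2 * card {j \<in> I. R j = R i})"
    by (simp flip: sum.distrib)
  also have "\<dots> \<le> (\<Sum>i\<in>I. (a i)\<^sup>2 * k)"
    using mult by (intro sum_mono mult_left_mono) auto
  finally show ?thesis
    by (simp add: second_moment_chi_sum[OF p R] sum_distrib_left mult_ac)
qed

text \<open>
  An indicator equals its own powers and is an affine function of its normalisation, so multiplying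
  out a monomial gives characters on subsets of its variables, of which there are at most as many as
  its degree.
\<close>

lemma poly_eval_chi_expansion:
  assumes p: "0 < p" "p < 1" and F: "F \<in> polys_upto n d"
  shows "\<exists>c. \<forall>G. poly_eval F G = (\<Sum>S | S \<subseteq> pairs {1..n} \<and> card S \<le> d. c S * chi p S G)"
proof -
  define s where "s = sqrt (p * (1 - p))"
  have s: "s > 0" using p by (simp add: s_def)
  let ?\<S> = "{S. S \<subseteq> pairs {1..n} \<and> card S \<le> d}"
  have finP: "finite (pairs {1..n})" by (simp add: finite_pairs)
  have finS: "finite ?\<S>" by (rule finite_subset[of _ "Pow (pairs {1..n})"]) (use finP in auto)
  define b :: "nat set set \<Rightarrow> nat set set \<Rightarrow> real" where "b = (\<lambda>K S. if S \<subseteq> K then s ^ card S * p ^ card (K - S) else 0)"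
  have mono: "(\<Prod>e \<in> Poly_Mapping.keys m. of_bool (G e) ^ Poly_Mapping.lookup m e)
      = (\<Sum>S\<in>?\<S>. b (Poly_Mapping.keys m) S * chi p S G)"
    if m: "m \<in> Poly_Mapping.keys F" for m and G :: gvec
  proof -
    let ?K = "Poly_Mapping.keys m"
    have K: "?K \<subseteq> pairs {1..n}" and deg: "(\<Sum>e \<in> ?K. Poly_Mapping.lookup m e) \<le> d"
      using F m by (auto simp: polys_upto_def)
    have "card ?K = (\<Sum>e\<in>?K. 1)" by simp
    also have "\<dots> \<le> (\<Sum>e \<in> ?K. Poly_Mapping.lookup m e)"
      by (intro sum_mono) (simp add: Suc_le_eq in_keys_iff)
    finally have card: "card ?K \<le> d" using deg by simp
    have "(\<Prod>e \<in> ?K. of_bool (G e) ^ Poly_Mapping.lookup m e)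
       = (\<Prod>e \<in> ?K. (of_bool (G e) - p) / s * s + p)"
      using s by (intro prod.cong) (auto simp: in_keys_iff)
    also have "\<dots> = (\<Sum>S\<in>Pow ?K. (\<Prod>e\<in>S. (of_bool (G e) - p) / s * s) * (\<Prod>e\<in>?K-S. p))"
      by (rule prod_add) simp
    also have "\<dots> = (\<Sum>S\<in>Pow ?K. b ?K S * chi p S G)"
      by (intro sum.cong refl) (unfold prod.distrib chi_def s_def[symmetric] b_def, simp)
    also have "\<dots> = (\<Sum>S\<in>?\<S>. b ?K S * chi p S G)"
    proof (rule sum.mono_neutral_left[OF finS])
      show "Pow ?K \<subseteq> ?\<S>"
        using K card by (auto intro: order_trans[OF card_mono[OF finite_keys]])
    qed (auto simp: b_def)
    finally show ?thesis .
  qed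
  show ?thesis
  proof (intro exI allI)
    fix G
    have "poly_eval F G = (\<Sum>m \<in> Poly_Mapping.keys F. Poly_Mapping.lookup F m * (\<Sum>S\<in>?\<S>. b (Poly_Mapping.keys m) S * chi p S G))"
      unfolding poly_eval_def by (intro sum.cong refl arg_cong2[where f="(*)"] mono)
    also have "\<dots> = (\<Sum>S\<in>?\<S>. (\<Sum>m \<in> Poly_Mapping.keys F. Poly_Mapping.lookup F m * b (Poly_Mapping.keys m) S) * chi p S G)"
      unfolding sum_distrib_left sum_distrib_right by (subst sum.swap) (simp add: mult_ac)
    finally show "poly_eval F G = (\<Sum>S\<in>?\<S>. (\<Sum>m \<in> Poly_Mapping.keys F. Poly_Mapping.lookup F m * b (Poly_Mapping.keys m) S) * chi p S G)" .
  qed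
qed

section \<open>The planted distribution\<close>

definition embeddings :: "nat \<Rightarrow> 'v sgraph \<Rightarrow> ('v \<Rightarrow> nat) set" where
  "embeddings n H = {\<sigma> \<in> verts H \<rightarrow>\<^sub>E {1..n}. inj_on \<sigma> (verts H)}"

definition copy :: "'v sgraph \<Rightarrow> ('v \<Rightarrow> nat) \<Rightarrow> nat set set" where
  "copy H \<sigma> = (\<lambda>d. \<sigma> ` d) ` edges H"

definition plant :: "'a set \<Rightarrow> ('a \<Rightarrow> bool) \<Rightarrow> 'a \<Rightarrow> bool" where
  "plant E G = (\<lambda>e. G e \<or> e \<in> E)"

lemma finite_embeddings: "finite (verts H) \<Longrightarrow> finite (embeddings n H)"
  unfolding embeddings_def by (rule finite_subset[of _ "verts H \<rightarrow>\<^sub>E {1..n}"]) (auto intro: finite_PiE)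

lemma card_embeddings:
  assumes "finite (verts H)"
  shows "card (embeddings n H) = (\<Prod>i<card (verts H). n - i)"
  using card_inj_on_subset_funcset[OF assms, of "{1..n}" "verts H"]
  by (simp add: embeddings_def atLeast0LessThan)

lemma card_embeddings_pos:
  assumes "finite (verts H)" "card (verts H) \<le> n"
  shows "card (embeddings n H) > 0"
  using assms by (auto simp: card_embeddings intro!: prod_pos)

lemma expectation_planted:
  assumes "finite (verts H)" "card (verts H) \<le> n"
  shows "measure_pmf.expectation (planted n p H) f =
    (\<Sum>\<sigma>\<in>embeddings n H. measure_pmf.expectation (gnp n p) (\<lambda>G. f (plant (copy H \<sigma>) G))) / card (embeddings n H)"
proof -
  have ne: "embeddings n H \<noteq> {}" "finite (embeddings n H)"
    using card_embeddings_pos[OF assms] by (auto simp: card_gt_0_iff)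
  have "planted n p H = bind_pmf (pmf_of_set (embeddings n H)) (\<lambda>\<sigma>. map_pmf (plant (copy H \<sigma>)) (gnp n p))"
    unfolding planted_def embeddings_def plant_def copy_def map_pmf_def by (rule bind_commute_pmf)
  then show ?thesis
    using ne by (simp add: pmf_expectation_bind_pmf_of_set finite_set_gnp integral_map_pmf
       sum_divide_distrib divide_inverse_commute flip: divide_inverse sum_distrib_left)
qed

lemma finite_set_planted:
  assumes "finite (verts H)" "card (verts H) \<le> n"
  shows "finite (set_pmf (planted n p H))"
proof -
  have ne: "embeddings n H \<noteq> {}" "finite (embeddings n H)"
    using card_embeddings_pos[OF assms] by (auto simp: card_gt_0_iff)
  then show ?thesis unfolding planted_def embeddings_def
    by (auto simp: finite_set_gnp)
qed

lemma integrable_planted: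
  assumes "finite (verts H)" "card (verts H) \<le> n"
  shows "integrable (measure_pmf (planted n p H)) (f :: gvec \<Rightarrow> real)"
  by (rule integrable_measure_pmf_finite[OF finite_set_planted[OF assms]])

text \<open>
  The planted edges of \<open>S\<close> turn into constants and the others are untouched. All computations under
  the planted distribution rest on this identity.
\<close>

lemma chi_plant:
  assumes "0 < p" "p < 1" "finite S"
  shows "chi p S (plant E G) = edge_signal p ^ card (S \<inter> E) * chi p (S - E) G"
proof -
  have "chi p S (plant E G) = chi p (S \<inter> E) (plant E G) * chi p (S - E) (plant E G)"
    unfolding chi_def using prod.Int_Diff[OF assms(3)] by blast
  also have "chi p (S \<inter> E) (plant E G) = (\<Prod>e\<in>S \<inter> E. edge_signal p)"
    unfolding chi_def plant_def by (intro prod.cong) (auto simp: normalized_present_edge[OF assms(1,2)])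
  also have "chi p (S - E) (plant E G) = chi p (S - E) G"
    unfolding chi_def plant_def by (intro prod.cong) auto
  finally show ?thesis by simp
qed

lemma expectation_gnp_chi_plant:
  assumes "0 < p" "p < 1" "S \<subseteq> pairs {1..n}"
  shows "measure_pmf.expectation (gnp n p) (\<lambda>G. chi p S (plant E G)) = edge_signal p ^ card S * of_bool (S \<subseteq> E)"
proof -
  have "finite S" using assms finite_pairs finite_subset by blast
  then have "measure_pmf.expectation (gnp n p) (\<lambda>G. chi p S (plant E G))
     = edge_signal p ^ card (S \<inter> E) * of_bool (S - E = {})"
    using assms by (subst expectation_gnp_chi[symmetric, of p _ n]) (auto simp: chi_plant)
  then show ?thesis by (auto simp: Int_absorb2)
qed

lemma expectation_planted_chi:
  assumes "finite (verts H)" "card (verts H) \<le> n" "0 < p" "p < 1" "S \<subseteq> pairs {1..n}"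
  shows "measure_pmf.expectation (planted n p H) (chi p S) =
    edge_signal p ^ card S * (card {\<sigma> \<in> embeddings n H. S \<subseteq> copy H \<sigma>} / card (embeddings n H))"
  using finite_embeddings[OF assms(1)]
  by (simp add: expectation_planted[OF assms(1,2)] expectation_gnp_chi_plant[OF assms(3-5)]
     sum.If_cases of_bool_def Int_def flip: sum_distrib_left)

section \<open>Advantage and separation\<close>

lemma poly_eval_superset:
  assumes "finite K" "Poly_Mapping.keys F \<subseteq> K"
  shows "poly_eval F G = (\<Sum>m \<in> K. Poly_Mapping.lookup F m *
        (\<Prod>e \<in> Poly_Mapping.keys m. of_bool (G e) ^ Poly_Mapping.lookup m e))"
  unfolding poly_eval_def using assms by (intro sum.mono_neutral_left) (auto simp: in_keys_iff)

lemma polys_upto_uminus: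
  assumes "F \<in> polys_upto n d"
  shows "- F \<in> polys_upto n d" "poly_eval (- F) G = - poly_eval F G"
  using assms by (auto simp: polys_upto_def poly_eval_def sum_negf)

lemma polys_upto_shift:
  assumes "F \<in> polys_upto n d"
  shows "F - Poly_Mapping.single 0 c \<in> polys_upto n d"
    and "poly_eval (F - Poly_Mapping.single 0 c) G = poly_eval F G - c"
proof -
  let ?K = "insert 0 (Poly_Mapping.keys F)"
  have sub: "Poly_Mapping.keys (F - Poly_Mapping.single 0 c) \<subseteq> ?K"
    by (auto simp: in_keys_iff lookup_minus lookup_single when_def split: if_splits)
  then show "F - Poly_Mapping.single 0 c \<in> polys_upto n d"
    using assms by (fastforce simp: polys_upto_def)
  have "poly_eval (F - Poly_Mapping.single 0 c) G =
     (\<Sum>m\<in>?K. Poly_Mapping.lookup F m * (\<Prod>e \<in> Poly_Mapping.keys m. of_bool (G e) ^ Poly_Mapping.lookup m e)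
        - (if m = 0 then c else 0))"
    unfolding poly_eval_superset[OF _ sub, simplified]
    by (intro sum.cong refl) (auto simp: lookup_minus lookup_single algebra_simps when_def)
  also have "\<dots> = poly_eval F G - c"
    by (subst sum_subtractf) (subst poly_eval_superset[of ?K F], auto)
  finally show "poly_eval (F - Poly_Mapping.single 0 c) G = poly_eval F G - c" .
qed

text \<open>
  The squared norm of the projection of the likelihood ratio onto polynomials of degree at most
  \<open>d\<close>.
\<close>

definition low_degree_energy :: "nat \<Rightarrow> real \<Rightarrow> 'v sgraph \<Rightarrow> nat \<Rightarrow> real" where
  "low_degree_energy n p H d = (\<Sum>S | S \<subseteq> pairs {1..n} \<and> card S \<le> d.
     (measure_pmf.expectation (planted n p H) (chi p S))\<^sup>2)"

text \<open>
  Cauchy-Schwarz in the character basis.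
\<close>

lemma expectation_planted_poly_le:
  assumes H: "finite (verts H)" "card (verts H) \<le> n" and p: "0 < p" "p < 1" and F: "F \<in> polys_upto n d"
  shows "(measure_pmf.expectation (planted n p H) (poly_eval F))\<^sup>2
    \<le> measure_pmf.expectation (gnp n p) (\<lambda>G. (poly_eval F G)\<^sup>2) * low_degree_energy n p H d"
proof -
  let ?\<S> = "{S. S \<subseteq> pairs {1..n} \<and> card S \<le> d}"
  obtain c where c: "\<And>G. poly_eval F G = (\<Sum>S\<in>?\<S>. c S * chi p S G)"
    using poly_eval_chi_expansion[OF p F] by blast
  have fin: "finite ?\<S>"
    by (rule finite_subset[of _ "Pow (pairs {1..n})"]) (use finite_pairs in auto)
  have Q: "measure_pmf.expectation (gnp n p) (\<lambda>G. (poly_eval F G)\<^sup>2) = (\<Sum>S\<in>?\<S>. (c S)\<^sup>2)"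
    unfolding c using fin by (intro parseval_chi p) auto
  have "measure_pmf.expectation (planted n p H) (poly_eval F)
     = (\<Sum>S\<in>?\<S>. c S * measure_pmf.expectation (planted n p H) (chi p S))"
    unfolding c[abs_def] by (subst Bochner_Integration.integral_sum) (auto intro: integrable_planted H)
  then show ?thesis
    unfolding Q low_degree_energy_def by (simp add: Cauchy_Schwarz_ineq_sum)
qed

lemma adv_poly_le:
  assumes "finite (verts H)" "card (verts H) \<le> n" "0 < p" "p < 1" "F \<in> polys_upto n d"
  shows "adv n p H (poly_eval F) \<le> sqrt (low_degree_energy n p H d)"
proof -
  let ?q = "measure_pmf.expectation (gnp n p) (\<lambda>G. (poly_eval F G)\<^sup>2)"
  have q0: "?q \<ge> 0" by (intro integral_nonneg_AE) simp
  have "measure_pmf.expectation (planted n p H) (poly_eval F) \<le> sqrt (?q * low_degree_energy n p H d)"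
    by (rule real_le_rsqrt[OF expectation_planted_poly_le[OF assms]])
  then have le: "measure_pmf.expectation (planted n p H) (poly_eval F) \<le> sqrt (low_degree_energy n p H d) * sqrt ?q"
    by (simp add: real_sqrt_mult mult.commute)
  show ?thesis
  proof (cases "?q = 0")
    case True
    then show ?thesis by (simp add: adv_def low_degree_energy_def sum_nonneg)
  next
    case False
    then have "?q > 0" using q0 by linarith
    then have "sqrt ?q > 0" by (simp only: real_sqrt_gt_0_iff)
    then show ?thesis unfolding adv_def using le by (simp add: pos_divide_le_eq)
  qed
qed

lemma adv_upto_le:
  assumes "finite (verts H)" "card (verts H) \<le> n" "0 < p" "p < 1"
  shows "adv_upto n p H d \<le> ereal (sqrt (low_degree_energy n p H d))"
  unfolding adv_upto_def by (rule SUP_least) (auto intro: adv_poly_le[OF assms])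

text \<open>
  The witness is the polynomial minus its null mean, with its sign chosen to make the planted mean
  positive. It cannot have null second moment zero, since then its planted mean would vanish too.
\<close>

lemma separation_ratio_le_adv_upto:
  assumes H: "finite (verts H)" "card (verts H) \<le> n" and p: "0 < p" "p < 1" and F: "F \<in> polys_upto n d"
    and ne: "measure_pmf.expectation (planted n p H) (poly_eval F) \<noteq> measure_pmf.expectation (gnp n p) (poly_eval F)"
  shows "measure_pmf.variance (gnp n p) (poly_eval F) > 0"
    and "ereal (\<bar>measure_pmf.expectation (planted n p H) (poly_eval F) - measure_pmf.expectation (gnp n p) (poly_eval F)\<bar>
       / sqrt (measure_pmf.variance (gnp n p) (poly_eval F))) \<le> adv_upto n p H d"
proof -
  let ?P = "measure_pmf.expectation (planted n p H)" and ?Q = "measure_pmf.expectation (gnp n p)"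
  define \<mu> where "\<mu> = ?Q (poly_eval F)"
  define F0 where "F0 = F - Poly_Mapping.single 0 \<mu>"
  define F1 where "F1 = (if ?P (poly_eval F) \<ge> \<mu> then F0 else - F0)"
  have F0: "F0 \<in> polys_upto n d" "poly_eval F0 G = poly_eval F G - \<mu>" for G
    unfolding F0_def using polys_upto_shift[OF F] by auto
  have F1: "F1 \<in> polys_upto n d" using F0 polys_upto_uminus by (auto simp: F1_def)
  have P0: "?P (\<lambda>G. poly_eval F G - \<mu>) = ?P (poly_eval F) - \<mu>"
    using integrable_planted[OF H] by (subst Bochner_Integration.integral_diff) auto
  have P1: "?P (poly_eval F1) = \<bar>?P (poly_eval F) - \<mu>\<bar>"
  proof (cases "?P (poly_eval F) \<ge> \<mu>")
    case True
    then have "poly_eval F1 = (\<lambda>G. poly_eval F G - \<mu>)" by (auto simp: F1_def F0(2))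
    then show ?thesis using True P0 by simp
  next
    case False
    then have "poly_eval F1 = (\<lambda>G. - (poly_eval F G - \<mu>))"
      by (auto simp: F1_def F0(2) polys_upto_uminus(2)[OF F0(1)])
    then have "?P (poly_eval F1) = - ?P (\<lambda>G. poly_eval F G - \<mu>)"
      by (simp only: Bochner_Integration.integral_minus)
    then show ?thesis using False P0 by simp
  qed
  have Q1: "?Q (\<lambda>G. (poly_eval F1 G)\<^sup>2) = measure_pmf.variance (gnp n p) (poly_eval F)"
    by (auto simp: F1_def polys_upto_uminus(2)[OF F0(1)] F0(2) \<mu>_def power2_commute)
  have "?P (poly_eval F1) \<noteq> 0" using P1 ne by (simp add: \<mu>_def)
  then have "?Q (\<lambda>G. (poly_eval F1 G)\<^sup>2) \<noteq> 0"
    using expectation_planted_poly_le[OF H p F1] by auto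
  moreover have "?Q (\<lambda>G. (poly_eval F1 G)\<^sup>2) \<ge> 0" by (intro integral_nonneg_AE) simp
  ultimately show "measure_pmf.variance (gnp n p) (poly_eval F) > 0" unfolding Q1 by linarith
  have "\<exists>G. poly_eval F1 G \<noteq> 0"
  proof (rule ccontr)
    assume "\<nexists>G. poly_eval F1 G \<noteq> 0"
    then have "poly_eval F1 = (\<lambda>_. 0)" by (intro ext) blast
    then show False using \<open>?P (poly_eval F1) \<noteq> 0\<close> by simp
  qed
  then have "ereal (adv n p H (poly_eval F1)) \<le> adv_upto n p H d"
    unfolding adv_upto_def using F1 by (intro SUP_upper) auto
  then show "ereal (\<bar>?P (poly_eval F) - ?Q (poly_eval F)\<bar> / sqrt (measure_pmf.variance (gnp n p) (poly_eval F))) \<le> adv_upto n p H d"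
    unfolding adv_def P1 Q1 by (simp add: \<mu>_def)
qed

lemma bounded_advantage_excludes_separation:
  fixes H :: "nat \<Rightarrow> 'v sgraph"
  assumes H: "\<And>n. finite (verts (H n))" "\<And>n. card (verts (H n)) \<le> n"
    and p: "\<And>n. 0 < p n \<and> p n < 1"
    and bdd: "limsup (\<lambda>n. adv_upto n (p n) (H n) (D n)) < \<infinity>"
    and F: "\<And>n. F n \<in> polys_upto n (D n)"
  shows "\<not> strongly_separates (\<lambda>n. planted n (p n) (H n)) (\<lambda>n. gnp n (p n)) (\<lambda>n. poly_eval (F n))"
proof
  assume sep: "strongly_separates (\<lambda>n. planted n (p n) (H n)) (\<lambda>n. gnp n (p n)) (\<lambda>n. poly_eval (F n))"
  define \<Delta> where "\<Delta> = (\<lambda>n. \<bar>measure_pmf.expectation (planted n (p n) (H n)) (poly_eval (F n))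
     - measure_pmf.expectation (gnp n (p n)) (poly_eval (F n))\<bar>)"
  define v where "v = (\<lambda>n. measure_pmf.variance (gnp n (p n)) (poly_eval (F n)))"
  define w where "w = (\<lambda>n. max (sqrt (measure_pmf.variance (planted n (p n) (H n)) (poly_eval (F n)))) (sqrt (v n)))"
  have sep': "eventually (\<lambda>n. \<Delta> n \<noteq> 0) sequentially" "(\<lambda>n. w n / \<Delta> n) \<longlonglongrightarrow> 0"
    using sep unfolding strongly_separates_def negligible_wrt_def \<Delta>_def v_def w_def by auto
  obtain M where M: "limsup (\<lambda>n. adv_upto n (p n) (H n) (D n)) < ereal M"
    using bdd less_PInf_Ex_of_nat by force
  define M' where "M' = max M 1"
  have "M' > 0" by (simp add: M'_def)
  have "eventually (\<lambda>n. adv_upto n (p n) (H n) (D n) < ereal M) sequentially"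
    using M by (rule Limsup_lessD)
  moreover have "eventually (\<lambda>n. w n / \<Delta> n < 1 / M') sequentially"
    using sep'(2) \<open>M' > 0\<close> by (intro order_tendstoD) auto
  ultimately have "eventually (\<lambda>n. False) sequentially"
    using sep'(1)
  proof eventually_elim
    case (elim n)
    have pn: "0 < p n" "p n < 1" using p by auto
    have ne: "measure_pmf.expectation (planted n (p n) (H n)) (poly_eval (F n)) \<noteq> measure_pmf.expectation (gnp n (p n)) (poly_eval (F n))"
      using elim(3) by (simp add: \<Delta>_def)
    note r = separation_ratio_le_adv_upto[OF H pn F[of n] ne]
    have "\<Delta> n > 0" using elim(3) by (simp add: \<Delta>_def)
    have "v n > 0" using r(1) by (simp add: v_def)
    have "ereal (\<Delta> n / sqrt (v n)) < ereal M"
      unfolding \<Delta>_def v_def by (rule le_less_trans[OF r(2) elim(1)])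
    then have "\<Delta> n / sqrt (v n) < M'" by (simp add: M'_def)
    then have "\<Delta> n < M' * sqrt (v n)" using \<open>v n > 0\<close> by (simp add: pos_divide_less_eq)
    also have "\<dots> \<le> M' * w n" using \<open>M' > 0\<close> by (simp add: w_def)
    finally have "1 / M' < w n / \<Delta> n" using \<open>M' > 0\<close> \<open>\<Delta> n > 0\<close> by (simp add: field_simps)
    then show False using elim(2) by simp
  qed
  then show False by simp
qed

section \<open>Spanning star forests\<close>

text \<open>
  Deleting an edge from a smallest edge cover uncovers some vertex, which is therefore private to that
  edge.
\<close>

lemma exists_minimal_edge_cover:
  assumes "finite S"
  shows "\<exists>M\<subseteq>S. \<Union>M = \<Union>S \<and> (\<forall>e\<in>M. \<exists>x. x \<in> e \<and> (\<forall>e'\<in>M. x \<in> e' \<longrightarrow> e' = e))"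
proof -
  obtain M where M: "M \<subseteq> S \<and> \<Union>M = \<Union>S" and min: "\<And>N. N \<subseteq> S \<and> \<Union>N = \<Union>S \<Longrightarrow> card M \<le> card N"
    using ex_has_least_nat[of "\<lambda>M. M \<subseteq> S \<and> \<Union>M = \<Union>S" S card] by blast
  have fin: "finite M" using M assms finite_subset by auto
  have "\<exists>x. x \<in> e \<and> (\<forall>e'\<in>M. x \<in> e' \<longrightarrow> e' = e)" if e: "e \<in> M" for e
  proof (rule ccontr)
    assume "\<not> ?thesis"
    then have "\<Union>(M - {e}) = \<Union>M" using e by blast
    then have "card M \<le> card (M - {e})" using M by (intro min) auto
    then show False using e fin by (metis card_Diff1_less not_less)
  qed
  then show ?thesis using M by blast
qed

text \<open>
  Take the private vertices of a minimal edge cover as leaves (one per edge) and all other vertices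
  as centres. The second endpoint of a cover edge is never private to another edge, and every vertex
  that was not chosen is such a second endpoint; so \<open>c\<close> maps the leaves onto the centres, and each
  centre carries at least one leaf.
\<close>

lemma exists_spanning_star_forest:
  assumes fin: "finite S" and two: "\<And>e. e \<in> S \<Longrightarrow> card e = 2"
  shows "\<exists>L c. L \<subseteq> \<Union>S \<and> \<Union>S - L = c ` L \<and> (\<forall>l\<in>L. {l, c l} \<in> S) \<and> card L \<le> card S"
proof -
  obtain M where M: "M \<subseteq> S" "\<Union>M = \<Union>S" and ex: "\<forall>e\<in>M. \<exists>x. x \<in> e \<and> (\<forall>e'\<in>M. x \<in> e' \<longrightarrow> e' = e)"
    using exists_minimal_edge_cover[OF fin] by (elim exE conjE)
  obtain x where xs: "\<forall>e\<in>M. x e \<in> e \<and> (\<forall>e'\<in>M. x e \<in> e' \<longrightarrow> e' = e)"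
    using bchoice[OF ex] by (elim exE)
  then have x: "x e \<in> e" and priv: "\<And>e'. e' \<in> M \<Longrightarrow> x e \<in> e' \<Longrightarrow> e' = e" if "e \<in> M" for e
    using that by simp_all
  define L where "L = x ` M"
  have other: "\<exists>y. y \<noteq> x e \<and> e = {x e, y}" if "e \<in> M" for e
  proof -
    have "card e = 2" using two that M(1) by blast
    then obtain a b where "e = {a, b}" "a \<noteq> b" by (auto simp: card_2_iff)
    with x[OF that] show ?thesis by auto
  qed
  have "\<forall>l\<in>L. \<exists>y. y \<noteq> l \<and> {l, y} \<in> M"
  proof
    fix l assume "l \<in> L"
    then obtain e where "e \<in> M" "l = x e" by (auto simp: L_def)
    then show "\<exists>y. y \<noteq> l \<and> {l, y} \<in> M" using other[of e] by auto
  qed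
  from bchoice[OF this] obtain c where cs: "\<forall>l\<in>L. c l \<noteq> l \<and> {l, c l} \<in> M"
    by (elim exE)
  then have c: "c l \<noteq> l" "{l, c l} \<in> M" if "l \<in> L" for l
    using that by simp_all
  have notL: "c l \<notin> L" if l: "l \<in> L" for l
  proof
    assume "c l \<in> L"
    then obtain e' where e': "e' \<in> M" "c l = x e'" by (auto simp: L_def)
    obtain e where e: "e \<in> M" "l = x e" using l by (auto simp: L_def)
    have "{l, c l} = e'" by (rule priv[OF e'(1) c(2)[OF l]]) (simp flip: e'(2))
    moreover have "{l, c l} = e" by (rule priv[OF e(1) c(2)[OF l]]) (simp flip: e(2))
    ultimately have "e = e'" by simp
    then show False using e(2) e'(2) c(1)[OF l] by simp
  qed
  have "\<Union>S - L = c ` L"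
  proof (intro equalityI subsetI)
    fix y assume y: "y \<in> \<Union>S - L"
    then have "y \<in> \<Union>M" by (simp only: M(2) Diff_iff)
    then obtain e where e: "e \<in> M" "y \<in> e" by (rule UnionE)
    have l: "x e \<in> L" using e by (simp add: L_def)
    have "{x e, c (x e)} = e" using priv[OF e(1) c(2)[OF l]] by simp
    then have "y \<in> {x e, c (x e)}" using e(2) by simp
    moreover have "y \<noteq> x e" using y l by auto
    ultimately have "y = c (x e)" by simp
    then show "y \<in> c ` L" using l by simp
  next
    fix y assume "y \<in> c ` L"
    then obtain l where l: "l \<in> L" "y = c l" by blast
    have "{l, c l} \<in> S" using c(2)[OF l(1)] M(1) by (rule rev_subsetD)
    then have "y \<in> \<Union>S" unfolding l(2) by (rule UnionI) simp
    then show "y \<in> \<Union>S - L" using notL[OF l(1)] l(2) by simp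
  qed
  moreover have "L \<subseteq> \<Union>S"
  proof
    fix l assume "l \<in> L"
    then show "l \<in> \<Union>S" using c(2) M(1) by (intro UnionI[of "{l, c l}"]) auto
  qed
  moreover have "card L \<le> card S" unfolding L_def
    using card_image_le[OF finite_subset[OF M(1) fin], of x] card_mono[OF fin M(1)] by linarith
  moreover have "\<forall>l\<in>L. {l, c l} \<in> S" using c(2) M(1) by auto
  ultimately show ?thesis by (intro exI[of _ L] exI[of _ c] conjI)
qed

definition deg :: "'v sgraph \<Rightarrow> 'v \<Rightarrow> nat" where
  "deg H w = card {v \<in> verts H. {w, v} \<in> edges H}"

text \<open>
  Place the centres freely; then each leaf has as many choices as the degree of the image of its
  centre. Distinct centres are independent, which turns the sum over placements into a product.
\<close>

lemma card_star_forest_homs: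
  assumes V: "finite (verts H)" and L: "finite L" and disj: "L \<inter> c ` L = {}"
  shows "card {g \<in> (L \<union> c ` L) \<rightarrow>\<^sub>E verts H. \<forall>l\<in>L. {g l, g (c l)} \<in> edges H}
    \<le> (\<Prod>k\<in>c ` L. \<Sum>w\<in>verts H. deg H w ^ card {l \<in> L. c l = k})"
proof -
  let ?C = "c ` L"
  let ?N = "\<lambda>w. {v \<in> verts H. {w, v} \<in> edges H}"
  let ?G = "{g \<in> (L \<union> ?C) \<rightarrow>\<^sub>E verts H. \<forall>l\<in>L. {g l, g (c l)} \<in> edges H}"
  let ?T = "SIGMA h:(?C \<rightarrow>\<^sub>E verts H). (\<Pi>\<^sub>E l\<in>L. ?N (h (c l)))"
  have finN: "finite (?N w)" for w using V by simp
  have finC: "finite (?C \<rightarrow>\<^sub>E verts H)" using V L by (intro finite_PiE) auto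
  have finI: "finite (\<Pi>\<^sub>E l\<in>L. ?N (h (c l)))" for h using L finN by (intro finite_PiE) auto
  have "card ?G \<le> card ?T"
  proof (rule card_inj_on_le)
    show "inj_on (\<lambda>g. (restrict g ?C, restrict g L)) ?G"
    proof (rule inj_onI)
      fix g g' assume g: "g \<in> ?G" "g' \<in> ?G" and eq: "(restrict g ?C, restrict g L) = (restrict g' ?C, restrict g' L)"
      have "g y = g' y" if "y \<in> L \<union> ?C" for y
        using eq that by (metis Pair_inject Un_iff restrict_apply')
      then show "g = g'" using g by (intro PiE_ext[of g "L \<union> ?C" _ g']) auto
    qed
    show "(\<lambda>g. (restrict g ?C, restrict g L)) ` ?G \<subseteq> ?T"
      by (auto simp: insert_commute PiE_iff)
    show "finite ?T" using finC finI by auto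
  qed
  also have "card ?T = (\<Sum>h\<in>?C \<rightarrow>\<^sub>E verts H. \<Prod>l\<in>L. deg H (h (c l)))"
    using finC finI L by (simp add: card_SigmaI card_PiE deg_def)
  also have "\<dots> = (\<Sum>h\<in>?C \<rightarrow>\<^sub>E verts H. \<Prod>k\<in>?C. deg H (h k) ^ card {l \<in> L. c l = k})"
  proof (rule sum.cong[OF refl])
    fix h
    have "(\<Prod>l\<in>L. deg H (h (c l))) = (\<Prod>k\<in>?C. \<Prod>l\<in>{l \<in> L. c l = k}. deg H (h (c l)))"
      using L by (intro prod.group[symmetric]) auto
    also have "\<dots> = (\<Prod>k\<in>?C. \<Prod>l\<in>{l \<in> L. c l = k}. deg H (h k))"
      by (intro prod.cong) auto
    finally show "(\<Prod>l\<in>L. deg H (h (c l))) = (\<Prod>k\<in>?C. deg H (h k) ^ card {l \<in> L. c l = k})"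
      by simp
  qed
  also have "\<dots> = (\<Prod>k\<in>?C. \<Sum>w\<in>verts H. deg H w ^ card {l \<in> L. c l = k})"
    using L V by (intro prod_sum_PiE[symmetric]) auto
  finally show ?thesis .
qed

section \<open>Star moments bound the low-degree energy\<close>

text \<open>
  Under a uniformly random embedding, prescribing the preimages of the points of \<open>A\<close> has probability
  at most the inverse of the falling factorial of \<open>n\<close> of length \<open>card A\<close>: what is left is an
  injection of the remaining vertices into the remaining points.
\<close>

lemma card_embeddings_fixed_le:
  assumes V: "finite (verts H)" and A: "A \<subseteq> {1..n}" and g: "g ` A \<subseteq> verts H" and h: "card (verts H) \<le> n"
  shows "card {\<sigma> \<in> embeddings n H. \<forall>i\<in>A. \<sigma> (g i) = i} * (\<Prod>i<card A. n - i) \<le> card (embeddings n H)"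
proof (cases "{\<sigma> \<in> embeddings n H. \<forall>i\<in>A. \<sigma> (g i) = i} = {}")
  case False
  let ?E = "{\<sigma> \<in> embeddings n H. \<forall>i\<in>A. \<sigma> (g i) = i}"
  let ?W = "verts H - g ` A"
  let ?I = "{\<tau> \<in> ?W \<rightarrow>\<^sub>E ({1..n} - A). inj_on \<tau> ?W}"
  have finA: "finite A" using A finite_subset by blast
  have "inj_on g A" using False by (metis (mono_tags, lifting) empty_Collect_eq inj_onI)
  then have cA: "card (g ` A) = card A" by (rule card_image)
  have vh: "card A \<le> card (verts H)" using cA card_mono[OF V g] by simp
  have cW: "card ?W = card (verts H) - card A" using V g cA by (simp add: card_Diff_subset finite_subset)
  have cB: "card ({1..n} - A) = n - card A" using A finA by (simp add: card_Diff_subset)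
  have "card ?E \<le> card ?I"
  proof (rule card_inj_on_le)
    show "inj_on (\<lambda>\<sigma>. restrict \<sigma> ?W) ?E"
    proof (rule inj_onI)
      fix \<sigma> \<sigma>' assume s: "\<sigma> \<in> ?E" "\<sigma>' \<in> ?E" and eq: "restrict \<sigma> ?W = restrict \<sigma>' ?W"
      have "\<sigma> w = \<sigma>' w" if "w \<in> verts H" for w
      proof (cases "w \<in> g ` A")
        case True then show ?thesis using s by auto
      next
        case False then show ?thesis using fun_cong[OF eq, of w] that by simp
      qed
      then show "\<sigma> = \<sigma>'" using s by (intro PiE_ext[of \<sigma> "verts H" _ \<sigma>']) (auto simp: embeddings_def)
    qed
    show "(\<lambda>\<sigma>. restrict \<sigma> ?W) ` ?E \<subseteq> ?I"
    proof (rule image_subsetI)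
      fix \<sigma> assume s: "\<sigma> \<in> ?E"
      have inj: "inj_on \<sigma> (verts H)" and mem: "\<And>w. w \<in> verts H \<Longrightarrow> \<sigma> w \<in> {1..n}"
        using s by (auto simp: embeddings_def PiE_iff)
      have "\<sigma> w \<notin> A" if w: "w \<in> ?W" for w
      proof
        assume i: "\<sigma> w \<in> A"
        then have "\<sigma> (g (\<sigma> w)) = \<sigma> w" using s by auto
        then have "g (\<sigma> w) = w" using inj g i w by (auto dest!: inj_onD)
        then show False using w i by (metis DiffD2 imageI)
      qed
      then show "restrict \<sigma> ?W \<in> ?I" using mem inj by (auto intro: inj_on_subset)
    qed
    show "finite ?I" by (rule finite_subset[of _ "?W \<rightarrow>\<^sub>E ({1..n} - A)"]) (use V in \<open>auto intro: finite_PiE\<close>)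
  qed
  also have "card ?I = card ({1..n} - A) ^ (card ?W - card ?W) * prod ((-) (card ({1..n} - A))) {0..<card ?W}"
    using V by (intro card_inj_on_subset_funcset) auto
  also have "\<dots> = (\<Prod>i<card (verts H) - card A. n - card A - i)"
    by (simp only: cW cB diff_self_eq_0 power_0 mult_1 atLeast0LessThan)
  finally have "card ?E * (\<Prod>i<card A. n - i) \<le> (\<Prod>i<card A. n - i) * (\<Prod>i<card (verts H) - card A. n - (i + card A))"
    by (simp add: add.commute)
  also have "(\<Prod>i<card (verts H) - card A. n - (i + card A)) = (\<Prod>i\<in>{card A..<card (verts H)}. n - i)"
    using prod.shift_bounds_nat_ivl[of "\<lambda>i. n - i" 0 "card A" "card (verts H) - card A"] vh
    by (simp add: lessThan_atLeast0)
  also have "(\<Prod>i<card A. n - i) * \<dots> = card (embeddings n H)"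
    unfolding card_embeddings[OF V] lessThan_atLeast0 using vh by (intro prod.atLeastLessThan_concat) auto
  finally show ?thesis .
qed (metis (no_types, lifting) card.empty mult_0 zero_le)

lemma binomial_le_power: "n choose k \<le> n ^ k"
  using binomial_le_pow[of k n] by (cases "k \<le> n") (auto simp: binomial_eq_0)

lemma falling_factorial_ge:
  assumes "v \<le> n"
  shows "real n ^ v \<le> real v ^ v * real (\<Prod>i<v. n - i)"
proof -
  have "real n ^ v = (\<Prod>i<v. real n)" by simp
  also have "\<dots> \<le> (\<Prod>i<v. real v * real (n - i))"
  proof (rule prod_mono)
    fix i assume i: "i \<in> {..<v}"
    have "real i * real v \<le> (real v - 1) * real v" using i by (intro mult_right_mono) auto
    moreover have "0 \<le> (real v - 1) * (real n - real v)" using i assms by (intro mult_nonneg_nonneg) auto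
    ultimately have "real n \<le> real v * (real n - real i)" by (simp add: algebra_simps)
    then show "0 \<le> real n \<and> real n \<le> real v * real (n - i)" using i assms by (simp add: of_nat_diff)
  qed
  also have "\<dots> = real v ^ v * real (\<Prod>i<v. n - i)" by (simp add: prod.distrib)
  finally show ?thesis .
qed

text \<open>
  The normalisation is the one for which the advantage of the signed count of the star with \<open>t\<close>
  edges is of the order of this quantity whenever it is large.
\<close>

definition star_moment :: "nat \<Rightarrow> real \<Rightarrow> 'v sgraph \<Rightarrow> nat \<Rightarrow> real" where
  "star_moment n p H t = (\<Sum>w\<in>verts H. (edge_signal p * deg H w / sqrt n) ^ t) / sqrt n"

lemma star_moment_nonneg: "0 < p \<Longrightarrow> p < 1 \<Longrightarrow> 0 \<le> star_moment n p H t"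
  unfolding star_moment_def by (intro divide_nonneg_nonneg sum_nonneg) (auto simp: edge_signal_nonneg)

lemma degree_power_sum_eq:
  assumes "n > 0"
  shows "edge_signal p ^ t * (\<Sum>w\<in>verts H. real (deg H w) ^ t) = star_moment n p H t * sqrt n ^ Suc t"
  using assms by (simp add: star_moment_def sum_divide_distrib sum_distrib_left sum_distrib_right
     power_mult_distrib power_divide)

text \<open>
  If the copy contains \<open>S\<close>, then pulling back the vertices of \<open>S\<close> gives a map that sends the forest
  edges of \<open>S\<close> to edges of \<open>H\<close>. The bound is a union bound over these maps.
\<close>

lemma card_copies_containing_le:
  assumes H: "simple_graph H" "card (verts H) \<le> n" and n: "n > 0"
    and S: "S \<subseteq> pairs {1..n}"
    and L: "\<Union>S = L \<union> c ` L" "L \<inter> c ` L = {}" "\<And>l. l \<in> L \<Longrightarrow> {l, c l} \<in> S"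
  shows "card {\<sigma> \<in> embeddings n H. S \<subseteq> copy H \<sigma>} / card (embeddings n H) \<le>
    (\<Prod>k\<in>c ` L. \<Sum>w\<in>verts H. real (deg H w) ^ card {l \<in> L. c l = k}) * (real (card (\<Union>S)) / n) ^ card (\<Union>S)"
proof -
  have V: "finite (verts H)" and E: "edges H \<subseteq> pairs (verts H)" using H by (auto simp: simple_graph_def)
  let ?A = "\<Union>S"
  have A: "?A \<subseteq> {1..n}" using S by (auto simp: pairs_def)
  have finA: "finite ?A" using A finite_subset by blast
  have finL: "finite L" using finA L(1) by auto
  have vn: "card ?A \<le> n" using card_mono[OF _ A] by simp
  define G where "G = {g \<in> (L \<union> c ` L) \<rightarrow>\<^sub>E verts H. \<forall>l\<in>L. {g l, g (c l)} \<in> edges H}"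
  define X where "X = (\<lambda>g. {\<sigma> \<in> embeddings n H. \<forall>i\<in>?A. \<sigma> (g i) = i})"
  have finG: "finite G" unfolding G_def
    by (rule finite_subset[of _ "(L \<union> c ` L) \<rightarrow>\<^sub>E verts H"]) (use finL V in \<open>auto intro!: finite_PiE\<close>)
  have finE: "finite (embeddings n H)" by (rule finite_embeddings[OF V])
  have sub: "{\<sigma> \<in> embeddings n H. S \<subseteq> copy H \<sigma>} \<subseteq> (\<Union>g\<in>G. X g)"
  proof
    fix \<sigma> assume s: "\<sigma> \<in> {\<sigma> \<in> embeddings n H. S \<subseteq> copy H \<sigma>}"
    then have inj: "inj_on \<sigma> (verts H)" and SH: "S \<subseteq> copy H \<sigma>" by (auto simp: embeddings_def)
    define g where "g = restrict (inv_into (verts H) \<sigma>) ?A"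
    have im: "?A \<subseteq> \<sigma> ` verts H"
    proof
      fix i assume "i \<in> ?A"
      then obtain d where "d \<in> edges H" "i \<in> \<sigma> ` d" using SH by (auto simp: copy_def)
      then show "i \<in> \<sigma> ` verts H" using E by (auto simp: pairs_def)
    qed
    have gi: "\<sigma> (g i) = i" "g i \<in> verts H" if "i \<in> ?A" for i
      using that im by (auto simp: g_def f_inv_into_f inv_into_into subset_iff)
    have "{g l, g (c l)} \<in> edges H" if l: "l \<in> L" for l
    proof -
      obtain d where d: "d \<in> edges H" "{l, c l} = \<sigma> ` d" using SH L(3)[OF l] by (auto simp: copy_def)
      have lA: "l \<in> ?A" "c l \<in> ?A" using L(1) l by auto
      have "\<sigma> ` {g l, g (c l)} = \<sigma> ` d" using d(2) gi lA by simp
      moreover have "{g l, g (c l)} \<subseteq> verts H" "d \<subseteq> verts H" using gi lA d E by (auto simp: pairs_def)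
      ultimately have "{g l, g (c l)} = d" using inj_on_image_eq_iff[OF inj] by blast
      then show ?thesis using d(1) by simp
    qed
    moreover have "g \<in> (L \<union> c ` L) \<rightarrow>\<^sub>E verts H"
      unfolding L(1)[symmetric] using gi by (auto simp: g_def PiE_iff)
    ultimately have "g \<in> G" by (simp add: G_def)
    then show "\<sigma> \<in> (\<Union>g\<in>G. X g)" using s gi by (auto simp: X_def)
  qed
  let ?ff = "\<Prod>i<card ?A. n - i"
  have "card {\<sigma> \<in> embeddings n H. S \<subseteq> copy H \<sigma>} \<le> card (\<Union>g\<in>G. X g)"
    by (rule card_mono[OF _ sub]) (use finG finE in \<open>auto simp: X_def\<close>)
  also have "\<dots> \<le> (\<Sum>g\<in>G. card (X g))" by (rule card_UN_le[OF finG])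
  finally have "card {\<sigma> \<in> embeddings n H. S \<subseteq> copy H \<sigma>} * ?ff \<le> (\<Sum>g\<in>G. card (X g) * ?ff)"
    by (simp flip: sum_distrib_right)
  also have "\<dots> \<le> (\<Sum>g\<in>G. card (embeddings n H))"
  proof (rule sum_mono)
    fix g assume "g \<in> G"
    then have "g ` ?A \<subseteq> verts H" unfolding L(1) G_def by (auto simp: PiE_iff)
    then show "card (X g) * ?ff \<le> card (embeddings n H)"
      unfolding X_def by (intro card_embeddings_fixed_le V A H(2))
  qed
  also have "\<dots> = card G * card (embeddings n H)" by simp
  finally have 1: "real (card {\<sigma> \<in> embeddings n H. S \<subseteq> copy H \<sigma>}) * real ?ff \<le> real (card G) * real (card (embeddings n H))"
    unfolding of_nat_mult[symmetric] of_nat_le_iff .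
  have emb: "real (card (embeddings n H)) > 0" using card_embeddings_pos[OF V H(2)] by simp
  let ?q = "card {\<sigma> \<in> embeddings n H. S \<subseteq> copy H \<sigma>} / card (embeddings n H)"
  have q0: "?q \<ge> 0" by simp
  have 2: "?q * real ?ff \<le> real (card G)" using 1 emb by (simp add: field_simps)
  have "?q * real n ^ card ?A \<le> ?q * (real (card ?A) ^ card ?A * real ?ff)"
    by (rule mult_left_mono[OF falling_factorial_ge[OF vn] q0])
  also have "\<dots> \<le> real (card ?A) ^ card ?A * real (card G)"
    using mult_left_mono[OF 2, of "real (card ?A) ^ card ?A"] by (simp add: mult_ac)
  finally have 3: "?q \<le> real (card G) * (real (card ?A) / n) ^ card ?A"
    using n by (simp add: power_divide field_simps)
  have "card G \<le> (\<Prod>k\<in>c ` L. \<Sum>w\<in>verts H. deg H w ^ card {l \<in> L. c l = k})"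
    unfolding G_def by (rule card_star_forest_homs[OF V finL L(2)])
  then have "real (card G) \<le> real (\<Prod>k\<in>c ` L. \<Sum>w\<in>verts H. deg H w ^ card {l \<in> L. c l = k})"
    by (simp only: of_nat_le_iff)
  then have "real (card G) \<le> (\<Prod>k\<in>c ` L. \<Sum>w\<in>verts H. real (deg H w) ^ card {l \<in> L. c l = k})"
    by simp
  then show ?thesis by (intro order_trans[OF 3] mult_right_mono) auto
qed

text \<open>
  Each forest edge pays for one factor \<open>edge_signal p\<close> of a star moment; each of the other edges of
  \<open>S\<close> costs a factor of at most \<open>\<Lambda>\<close>. A forest with leaves \<open>L\<close> and centres \<open>c ` L\<close> produces
  \<open>sqrt n ^ (card L + card (c ` L))\<close>, which is the square root of the power of \<open>n\<close> lost by fixing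
  the vertices of \<open>S\<close>.
\<close>

lemma expectation_planted_chi_le:
  assumes H: "simple_graph H" "card (verts H) \<le> n" and n: "n > 0" and p: "0 < p" "p < 1"
    and S: "S \<subseteq> pairs {1..n}" "card S \<le> d" and d: "d \<le> B" "1 \<le> B"
    and \<Lambda>: "edge_signal p \<le> \<Lambda>" "1 \<le> \<Lambda>"
    and M: "\<And>t. 1 \<le> t \<Longrightarrow> t \<le> d \<Longrightarrow> star_moment n p H t \<le> M" "1 \<le> M"
  shows "measure_pmf.expectation (planted n p H) (chi p S)
    \<le> (\<Lambda> * M) ^ B * real (2 * B) ^ (2 * B) / sqrt n ^ card (\<Union>S)"
proof -
  have V: "finite (verts H)" using H by (auto simp: simple_graph_def)
  have finS: "finite S" using S finite_pairs finite_subset by blast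
  have finU: "finite (\<Union>S)" using S(1) by (intro finite_subset[of "\<Union>S" "{1..n}"]) (auto simp: pairs_def)
  have "\<exists>L c. L \<subseteq> \<Union>S \<and> \<Union>S - L = c ` L \<and> (\<forall>l\<in>L. {l, c l} \<in> S) \<and> card L \<le> card S"
    by (rule exists_spanning_star_forest[OF finS]) (use S(1) in \<open>auto simp: pairs_def\<close>)
  then obtain L c where Lc: "L \<subseteq> \<Union>S" "\<Union>S - L = c ` L" "\<And>l. l \<in> L \<Longrightarrow> {l, c l} \<in> S" "card L \<le> card S"
    by blast
  have U: "\<Union>S = L \<union> c ` L" and disj: "L \<inter> c ` L = {}" using Lc(1,2) by auto
  have finL: "finite L" using finU Lc(1) finite_subset by blast
  let ?v = "card (\<Union>S)"
  let ?t = "\<lambda>k. card {l \<in> L. c l = k}"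
  have cC: "card (c ` L) \<le> card L" by (rule card_image_le[OF finL])
  have v: "?v = card L + card (c ` L)" unfolding U using finL disj by (intro card_Un_disjoint) auto
  have t1: "1 \<le> ?t k \<and> ?t k \<le> d" if "k \<in> c ` L" for k
  proof -
    have "{l \<in> L. c l = k} \<noteq> {}" using that by auto
    then have "?t k > 0" using finL by (simp add: card_gt_0_iff)
    moreover have "?t k \<le> card L" by (rule card_mono[OF finL]) auto
    ultimately show ?thesis using Lc(4) S(2) by linarith
  qed
  have sumt: "(\<Sum>k\<in>c ` L. ?t k) = card L"
    using sum.group[of L "c ` L" c "\<lambda>_. 1::nat"] finL by simp
  have sumSuc: "(\<Sum>k\<in>c ` L. Suc (?t k)) = ?v"
    unfolding v sumt[symmetric] by (simp only: Suc_eq_plus1 sum.distrib sum_constant mult_1_right of_nat_id)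
  have l0: "edge_signal p \<ge> 0" using edge_signal_nonneg p by simp
  have sn: "sqrt n > 0" using n by simp
  have "edge_signal p ^ card L * (\<Prod>k\<in>c ` L. \<Sum>w\<in>verts H. real (deg H w) ^ ?t k)
     = (\<Prod>k\<in>c ` L. edge_signal p ^ ?t k * (\<Sum>w\<in>verts H. real (deg H w) ^ ?t k))"
    by (simp add: prod.distrib flip: sumt power_sum)
  also have "\<dots> = (\<Prod>k\<in>c ` L. star_moment n p H (?t k) * sqrt n ^ Suc (?t k))"
    by (simp only: degree_power_sum_eq[OF n])
  also have "\<dots> \<le> (\<Prod>k\<in>c ` L. M * sqrt n ^ Suc (?t k))"
    using t1 M sn
    by (intro prod_mono conjI mult_right_mono mult_nonneg_nonneg star_moment_nonneg p) auto
  also have "\<dots> = M ^ card (c ` L) * sqrt n ^ ?v"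
    by (simp only: prod.distrib power_sum[symmetric] prod_constant sumSuc)
  finally have 1: "edge_signal p ^ card L * (\<Prod>k\<in>c ` L. \<Sum>w\<in>verts H. real (deg H w) ^ ?t k) \<le> M ^ card (c ` L) * sqrt n ^ ?v" .
  have cLB: "card L \<le> B" "card (c ` L) \<le> B" "card S \<le> B" using cC Lc(4) S(2) d by linarith+
  have "M ^ card (c ` L) \<le> M ^ B" using M(2) cLB by (intro power_increasing) auto
  then have 2: "edge_signal p ^ card L * (\<Prod>k\<in>c ` L. \<Sum>w\<in>verts H. real (deg H w) ^ ?t k) \<le> M ^ B * sqrt n ^ ?v"
    using sn by (intro order_trans[OF 1] mult_right_mono) auto
  have "edge_signal p ^ (card S - card L) \<le> \<Lambda> ^ (card S - card L)" using l0 \<Lambda> by (intro power_mono) auto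
  also have "\<dots> \<le> \<Lambda> ^ B" using \<Lambda> cLB by (intro power_increasing) auto
  finally have 3: "edge_signal p ^ (card S - card L) \<le> \<Lambda> ^ B" .
  have "?v \<le> 2 * B" using v cLB by linarith
  then have "real ?v ^ ?v \<le> real (2*B) ^ ?v" by (intro power_mono) auto
  also have "\<dots> \<le> real (2*B) ^ (2*B)" using d \<open>?v \<le> 2*B\<close> by (intro power_increasing) auto
  finally have 4: "real ?v ^ ?v \<le> real (2*B) ^ (2*B)" .
  have "measure_pmf.expectation (planted n p H) (chi p S)
     \<le> edge_signal p ^ card S * ((\<Prod>k\<in>c ` L. \<Sum>w\<in>verts H. real (deg H w) ^ ?t k) * (real ?v / n) ^ ?v)"
    unfolding expectation_planted_chi[OF V H(2) p S(1)]
    by (intro mult_left_mono card_copies_containing_le H n S U disj Lc(3)) (use l0 in auto)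
  also have "\<dots> = edge_signal p ^ (card S - card L) * (edge_signal p ^ card L * (\<Prod>k\<in>c ` L. \<Sum>w\<in>verts H. real (deg H w) ^ ?t k)) * (real ?v / n) ^ ?v"
  proof -
    have "edge_signal p ^ card S = edge_signal p ^ (card S - card L) * edge_signal p ^ card L"
      using Lc(4) by (simp add: power_add[symmetric])
    then show ?thesis by (simp only: mult.assoc)
  qed
  also have "\<dots> \<le> \<Lambda> ^ B * (M ^ B * sqrt n ^ ?v) * (real ?v / n) ^ ?v"
    using \<Lambda> l0 by (intro mult_right_mono mult_mono[OF 3 2] mult_nonneg_nonneg prod_nonneg sum_nonneg) auto
  also have "\<dots> = (\<Lambda> * M) ^ B * (sqrt n ^ ?v * real ?v ^ ?v / real n ^ ?v)"
    by (simp only: power_mult_distrib power_divide times_divide_eq_left times_divide_eq_right mult_ac)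
  also have "\<dots> = (\<Lambda> * M) ^ B * (real ?v ^ ?v / sqrt n ^ ?v)"
  proof -
    have "real n ^ ?v = (sqrt n * sqrt n) ^ ?v" by simp
    then have "real n ^ ?v = sqrt n ^ ?v * sqrt n ^ ?v" by (simp only: power_mult_distrib)
    then show ?thesis using sn by simp
  qed
  also have "(\<Lambda> * M) ^ B * (real ?v ^ ?v / sqrt n ^ ?v) \<le> (\<Lambda> * M) ^ B * (real (2*B) ^ (2*B) / sqrt n ^ ?v)"
    using 4 \<Lambda> M(2) sn by (intro mult_left_mono divide_right_mono) auto
  finally show ?thesis by (simp only: times_divide_eq_right)
qed

text \<open>
  Group the edge sets by their vertex set \<open>A\<close>. The at most \<open>n ^ v\<close> choices of \<open>A\<close> with \<open>card A = v\<close>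
  cancel the factor \<open>1 / n ^ v\<close> in the squared means.
\<close>

lemma low_degree_energy_le:
  assumes H: "simple_graph H" "card (verts H) \<le> n" and n: "n > 0" and p: "0 < p" "p < 1"
    and d: "d \<le> B" "1 \<le> B"
    and \<Lambda>: "edge_signal p \<le> \<Lambda>" "1 \<le> \<Lambda>"
    and M: "\<And>t. 1 \<le> t \<Longrightarrow> t \<le> d \<Longrightarrow> star_moment n p H t \<le> M" "1 \<le> M"
  shows "low_degree_energy n p H d \<le> ((\<Lambda> * M) ^ B * real (2 * B) ^ (2 * B))\<^sup>2 * (2 ^ 2 ^ (2 * B) * real (2 * B + 1))"
proof -
  have V: "finite (verts H)" using H by (auto simp: simple_graph_def)
  let ?\<S> = "{S. S \<subseteq> pairs {1..n} \<and> card S \<le> d}"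
  let ?\<A> = "{A. A \<subseteq> {1..n} \<and> card A \<le> 2 * B}"
  let ?K = "(\<Lambda> * M) ^ B * real (2 * B) ^ (2 * B)"
  have fin: "finite ?\<S>"
    by (rule finite_subset[of _ "Pow (pairs {1..n})"]) (use finite_pairs in auto)
  have finA: "finite ?\<A>" by (rule finite_subset[of _ "Pow {1..n}"]) auto
  have cU: "card (\<Union>S) \<le> 2 * B" if S: "S \<in> ?\<S>" for S
  proof -
    have "card (\<Union>S) \<le> (\<Sum>e\<in>S. card e)" by (rule card_Union_le_sum_card)
    also have "\<dots> = (\<Sum>e\<in>S. 2)" using S by (intro sum.cong) (auto simp: pairs_def)
    finally show ?thesis using S d by simp
  qed
  have "(\<Sum>S\<in>?\<S>. (measure_pmf.expectation (planted n p H) (chi p S))\<^sup>2) \<le> (\<Sum>S\<in>?\<S>. ?K\<^sup>2 / real n ^ card (\<Union>S))"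
  proof (rule sum_mono)
    fix S assume S: "S \<in> ?\<S>"
    have "0 \<le> measure_pmf.expectation (planted n p H) (chi p S)"
      using S edge_signal_nonneg[OF p] by (subst expectation_planted_chi[OF V H(2) p]) auto
    moreover have "measure_pmf.expectation (planted n p H) (chi p S) \<le> ?K / sqrt n ^ card (\<Union>S)"
      using S expectation_planted_chi_le[OF H n p _ _ d \<Lambda> M] by auto
    ultimately have "(measure_pmf.expectation (planted n p H) (chi p S))\<^sup>2 \<le> (?K / sqrt n ^ card (\<Union>S))\<^sup>2"
      by (rule power_mono[rotated])
    also have "\<dots> = ?K\<^sup>2 / real n ^ card (\<Union>S)"
    proof -
      have "(sqrt n ^ card (\<Union>S))\<^sup>2 = (sqrt n)\<^sup>2 ^ card (\<Union>S)"
        by (simp only: power_mult[symmetric] mult.commute)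
      then show ?thesis by (simp add: power_divide)
    qed
    finally show "(measure_pmf.expectation (planted n p H) (chi p S))\<^sup>2 \<le> ?K\<^sup>2 / real n ^ card (\<Union>S)" .
  qed
  also have "\<dots> = (\<Sum>A\<in>?\<A>. \<Sum>S\<in>{S\<in>?\<S>. \<Union>S = A}. ?K\<^sup>2 / real n ^ card (\<Union>S))"
  proof (rule sum.group[symmetric, OF fin finA])
    show "Union ` ?\<S> \<subseteq> ?\<A>" using cU by (auto simp: pairs_def)
  qed
  also have "\<dots> \<le> (\<Sum>A\<in>?\<A>. 2 ^ 2 ^ (2 * B) * (?K\<^sup>2 / real n ^ card A))"
  proof (rule sum_mono)
    fix A assume A: "A \<in> ?\<A>"
    then have fA: "finite A" using finite_subset by blast
    have "card {S\<in>?\<S>. \<Union>S = A} \<le> card (Pow (Pow A))" by (rule card_mono) (use fA in auto)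
    also have "\<dots> = 2 ^ 2 ^ card A" using fA by (simp add: card_Pow)
    also have "\<dots> \<le> 2 ^ 2 ^ (2 * B)" using A by (intro power_increasing) auto
    finally have "real (card {S\<in>?\<S>. \<Union>S = A}) \<le> real (2 ^ 2 ^ (2 * B))"
      by (simp only: of_nat_le_iff)
    then have "real (card {S\<in>?\<S>. \<Union>S = A}) \<le> 2 ^ 2 ^ (2 * B)"
      by (simp only: of_nat_power of_nat_numeral)
    moreover have "(\<Sum>S\<in>{S\<in>?\<S>. \<Union>S = A}. ?K\<^sup>2 / real n ^ card (\<Union>S)) = real (card {S\<in>?\<S>. \<Union>S = A}) * (?K\<^sup>2 / real n ^ card A)"
      by simp
    ultimately show "(\<Sum>S\<in>{S\<in>?\<S>. \<Union>S = A}. ?K\<^sup>2 / real n ^ card (\<Union>S)) \<le> 2 ^ 2 ^ (2 * B) * (?K\<^sup>2 / real n ^ card A)"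
      by (simp only:) (intro mult_right_mono, auto)
  qed
  also have "\<dots> = 2 ^ 2 ^ (2 * B) * ?K\<^sup>2 * (\<Sum>A\<in>?\<A>. 1 / real n ^ card A)"
    by (simp add: sum_distrib_left)
  finally have 1: "(\<Sum>S\<in>?\<S>. (measure_pmf.expectation (planted n p H) (chi p S))\<^sup>2)
     \<le> 2 ^ 2 ^ (2 * B) * ?K\<^sup>2 * (\<Sum>A\<in>?\<A>. 1 / real n ^ card A)" .
  have "(\<Sum>A\<in>?\<A>. 1 / real n ^ card A) = (\<Sum>v\<in>{..2*B}. \<Sum>A\<in>{A\<in>?\<A>. card A = v}. 1 / real n ^ card A)"
    by (rule sum.group[symmetric, OF finA]) auto
  also have "\<dots> \<le> (\<Sum>v\<in>{..2*B}. 1)"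
  proof (rule sum_mono)
    fix v assume "v \<in> {..2*B}"
    then have "{A\<in>?\<A>. card A = v} = {A. A \<subseteq> {1..n} \<and> card A = v}" by auto
    then have "card {A\<in>?\<A>. card A = v} = n choose v" by (simp add: n_subsets)
    moreover have "n choose v \<le> n ^ v" by (rule binomial_le_power)
    ultimately have "real (card {A\<in>?\<A>. card A = v}) \<le> real n ^ v"
      by (simp only: of_nat_power[symmetric] of_nat_le_iff)
    then show "(\<Sum>A\<in>{A\<in>?\<A>. card A = v}. 1 / real n ^ card A) \<le> 1"
      using n by (simp add: field_simps)
  qed
  also have "\<dots> = real (2 * B + 1)" by simp
  finally have 2: "(\<Sum>A\<in>?\<A>. 1 / real n ^ card A) \<le> real (2 * B + 1)" .
  have "2 ^ 2 ^ (2 * B) * ?K\<^sup>2 * (\<Sum>A\<in>?\<A>. 1 / real n ^ card A) \<le> 2 ^ 2 ^ (2 * B) * ?K\<^sup>2 * real (2 * B + 1)"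
    by (rule mult_left_mono[OF 2]) simp
  also have "\<dots> = ?K\<^sup>2 * (2 ^ 2 ^ (2 * B) * real (2 * B + 1))"
    by (simp only: mult_ac)
  finally show ?thesis unfolding low_degree_energy_def using 1 by (rule order_trans[rotated])
qed

section \<open>Stars as centres with leaf sets\<close>

definition star_at :: "'a \<Rightarrow> 'a set \<Rightarrow> 'a set set" where
  "star_at u L = (\<lambda>l. {u, l}) ` L"

text \<open>
  Pairs of a centre and \<open>t\<close> leaves. For \<open>t \<ge> 2\<close> they correspond to stars one to one; for \<open>t = 1\<close>
  every edge arises from both of its endpoints.
\<close>

definition centred_stars :: "'a set \<Rightarrow> nat \<Rightarrow> ('a \<times> 'a set) set" where
  "centred_stars V t = (SIGMA u:V. {L. L \<subseteq> V - {u} \<and> card L = t})"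

definition stars :: "'v sgraph \<Rightarrow> nat \<Rightarrow> 'v set set set" where
  "stars H t = {S. S \<subseteq> edges H \<and> graph_iso (\<Union>S, S) (star t)}"

lemma inj_on_star_at: "u \<notin> L \<Longrightarrow> inj_on (\<lambda>l. {u, l}) L"
  by (auto simp: inj_on_def doubleton_eq_iff)

lemma card_star_at: "u \<notin> L \<Longrightarrow> card (star_at u L) = card L"
  unfolding star_at_def by (rule card_image[OF inj_on_star_at])

lemma Union_star_at: "L \<noteq> {} \<Longrightarrow> \<Union>(star_at u L) = insert u L"
  by (auto simp: star_at_def)

lemma star_at_iso_star:
  assumes u: "u \<notin> L" and L: "card L = t" "t \<ge> 1"
  shows "graph_iso (\<Union>(star_at u L), star_at u L) (star t)"
proof -
  have fin: "finite L" and ne: "L \<noteq> {}" using L by (auto intro: card_ge_0_finite)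
  then obtain f where f: "bij_betw f L {1..t}"
    using L finite_same_card_bij[OF fin, of "{1..t}"] by auto
  define g where "g = (\<lambda>x. if x = u then 0 else f x)"
  have gL: "g x = f x" if "x \<in> L" for x using that u by (auto simp: g_def)
  have gu: "g u = 0" by (simp add: g_def)
  have "bij_betw g L {1..t}" using f gL by (simp cong: bij_betw_cong)
  then have "bij_betw g (insert u L) (insert 0 {1..t})"
    using u gu by (simp add: bij_betw_def)
  moreover have "insert 0 {1..t} = {0..t}" by auto
  ultimately have 1: "bij_betw g (insert u L) {0..t}" by simp
  have "(\<lambda>e. g ` e) ` star_at u L = (\<lambda>i. {0, i}) ` (f ` L)"
    unfolding star_at_def image_image by (intro image_cong) (auto simp: gu gL)
  also have "f ` L = {1..t}" using f by (simp add: bij_betw_def)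
  finally have 2: "(\<lambda>e. g ` e) ` star_at u L = {{0, i} | i. i \<in> {1..t}}" by auto
  show ?thesis unfolding graph_iso_def star_def Union_star_at[OF ne] using 1 2 by auto
qed

lemma iso_star_obtains:
  assumes "graph_iso (\<Union>S, S) (star t)" and two: "\<And>e. e \<in> S \<Longrightarrow> card e = 2"
  obtains u L where "S = star_at u L" "u \<notin> L" "card L = t" "u \<in> \<Union>S" "L \<subseteq> \<Union>S"
proof -
  obtain f where f: "bij_betw f (\<Union>S) {0..t}" and e: "(\<lambda>e. f ` e) ` S = {{0, i} | i. i \<in> {1..t}}"
    using assms by (auto simp: graph_iso_def star_def)
  define g where "g = inv_into (\<Union>S) f"
  have g: "bij_betw g {0..t} (\<Union>S)" unfolding g_def by (rule bij_betw_inv_into[OF f])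
  have inj: "inj_on g {0..t}" using g by (simp add: bij_betw_def)
  have mem: "g i \<in> \<Union>S" if "i \<le> t" for i using g that by (auto simp: bij_betw_def)
  have gf: "g ` f ` e = e" if "e \<in> S" for e
    unfolding g_def using f that by (intro inv_into_image_cancel) (auto simp: bij_betw_def)
  have "S = (\<lambda>e. g ` f ` e) ` S" using gf by simp
  also have "\<dots> = (\<lambda>e. g ` e) ` (\<lambda>e. f ` e) ` S" by (simp add: image_image)
  also have "(\<lambda>e. f ` e) ` S = (\<lambda>i. {0, i}) ` {1..t}" unfolding e by auto
  also have "(\<lambda>e. g ` e) ` \<dots> = star_at (g 0) (g ` {1..t})" by (simp add: star_at_def image_image)
  finally have S: "S = star_at (g 0) (g ` {1..t})" .
  have "g 0 \<notin> g ` {1..t}" using inj by (auto dest: inj_onD)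
  moreover have "card (g ` {1..t}) = t"
    using inj by (subst card_image) (auto intro: inj_on_subset)
  ultimately show ?thesis using mem by (intro that[OF S]) auto
qed

lemma star_at_subset_pairs:
  assumes "u \<in> V" "L \<subseteq> V - {u}"
  shows "star_at u L \<subseteq> pairs V"
  using assms by (auto simp: star_at_def pairs_def card_insert_if)

lemma stars_complete_eq:
  assumes "t \<ge> 1"
  shows "{S. S \<subseteq> pairs V \<and> graph_iso (\<Union>S, S) (star t)} = (\<lambda>(u, L). star_at u L) ` centred_stars V t"
proof (intro equalityI subsetI)
  fix S assume S: "S \<in> {S. S \<subseteq> pairs V \<and> graph_iso (\<Union>S, S) (star t)}"
  then have two: "card e = 2" if "e \<in> S" for e using that by (auto simp: pairs_def)
  have iso: "graph_iso (\<Union>S, S) (star t)" using S by simp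
  obtain u L where uL: "S = star_at u L" "u \<notin> L" "card L = t" "u \<in> \<Union>S" "L \<subseteq> \<Union>S"
    by (rule iso_star_obtains[OF iso two])
  moreover have "\<Union>S \<subseteq> V" using S by (auto simp: pairs_def)
  ultimately have "(u, L) \<in> centred_stars V t" by (auto simp: centred_stars_def)
  then show "S \<in> (\<lambda>(u, L). star_at u L) ` centred_stars V t" using uL(1) by force
next
  fix S assume "S \<in> (\<lambda>(u, L). star_at u L) ` centred_stars V t"
  then obtain u L where "S = star_at u L" "u \<in> V" "L \<subseteq> V - {u}" "card L = t"
    by (auto simp: centred_stars_def)
  then show "S \<in> {S. S \<subseteq> pairs V \<and> graph_iso (\<Union>S, S) (star t)}"
    using assms star_at_subset_pairs[of u V L] star_at_iso_star[of u L t] by auto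
qed

text \<open>
  The centre must be an endpoint of any chosen edge of the star, and it determines the leaves.
\<close>

lemma card_star_representations_le:
  assumes "R = star_at u L" "L \<noteq> {}" "u \<notin> L" and J: "\<And>v M. (v, M) \<in> J \<Longrightarrow> v \<notin> M"
  shows "card {(v, M) \<in> J. star_at v M = R} \<le> 2"
proof -
  obtain l where l: "l \<in> L" using assms(2) by auto
  have "(v, M) \<in> {(u, \<Union>R - {u}), (l, \<Union>R - {l})}" if "(v, M) \<in> J" "star_at v M = R" for v M
  proof -
    have v: "v \<notin> M" using J that(1) by auto
    have R: "star_at v M \<noteq> {}" using l that(2) assms(1) by (auto simp: star_at_def)
    then have "M \<noteq> {}" by (auto simp: star_at_def)
    then have M: "M = \<Union>R - {v}" using v that(2) Union_star_at[of M v] by auto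
    have "{u, l} \<in> star_at v M" using that(2) l assms(1) by (auto simp: star_at_def)
    then have "v = u \<or> v = l" by (auto simp: star_at_def doubleton_eq_iff)
    then show ?thesis using M by auto
  qed
  then have "{(v, M) \<in> J. star_at v M = R} \<subseteq> {(u, \<Union>R - {u}), (l, \<Union>R - {l})}" by auto
  then have "card {(v, M) \<in> J. star_at v M = R} \<le> card {(u, \<Union>R - {u}), (l, \<Union>R - {l})}"
    by (rule card_mono[rotated]) simp
  also have "\<dots> \<le> 2" by (simp add: card_insert_if)
  finally show ?thesis .
qed

lemma finite_centred_stars: "finite V \<Longrightarrow> finite (centred_stars V t)"
  unfolding centred_stars_def by (rule finite_SigmaI) auto

lemma card_centred_stars_le:
  "card (centred_stars {1..n} t) \<le> n ^ Suc t"
proof -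
  have "card (centred_stars {1..n} t) = (\<Sum>u\<in>{1..n}. (n - 1) choose t)"
    unfolding centred_stars_def by (subst card_SigmaI) (auto simp: n_subsets)
  also have "\<dots> = n * ((n - 1) choose t)" by simp
  also have "(n - 1) choose t \<le> (n - 1) ^ t" by (rule binomial_le_power)
  also have "(n - 1) ^ t \<le> n ^ t" by (intro power_mono) auto
  finally show ?thesis by simp
qed

text \<open>
  The number of stars inside the planted copy does not depend on where the copy is placed. This makes
  the conditional mean of the signed star count constant.
\<close>

lemma card_stars_copy:
  assumes H: "simple_graph H" and s: "inj_on \<sigma> (verts H)"
  shows "card {S. S \<subseteq> copy H \<sigma> \<and> graph_iso (\<Union>S, S) (star t)} = card (stars H t)"
proof -
  have E: "edges H \<subseteq> pairs (verts H)" using H by (auto simp: simple_graph_def)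
  define \<phi> where "\<phi> = (\<lambda>d. \<sigma> ` d)"
  have injV: "inj_on \<phi> (Pow (verts H))" unfolding \<phi>_def using s by (rule inj_on_image_Pow)
  have EP: "edges H \<subseteq> Pow (verts H)" using E by (auto simp: pairs_def)
  have injE: "inj_on \<phi> (edges H)" using injV EP by (rule inj_on_subset)
  have cp: "copy H \<sigma> = \<phi> ` edges H" by (simp add: copy_def \<phi>_def)
  have iso: "graph_iso (\<Union>(\<phi> ` S), \<phi> ` S) (star t) \<longleftrightarrow> graph_iso (\<Union>S, S) (star t)" if S: "S \<subseteq> edges H" for S
  proof -
    have US: "\<Union>S \<subseteq> verts H" using S EP by auto
    then have inj: "inj_on \<sigma> (\<Union>S)" using s inj_on_subset by blast
    have U: "\<Union>(\<phi> ` S) = \<sigma> ` \<Union>S" by (auto simp: \<phi>_def)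
    show ?thesis
    proof
      assume "graph_iso (\<Union>S, S) (star t)"
      then obtain f where f: "bij_betw f (\<Union>S) {0..t}" "(\<lambda>e. f ` e) ` S = edges (star t)"
        by (auto simp: graph_iso_def star_def)
      define g where "g = f \<circ> inv_into (\<Union>S) \<sigma>"
      have "bij_betw (inv_into (\<Union>S) \<sigma>) (\<sigma> ` \<Union>S) (\<Union>S)"
        using inj by (intro bij_betw_inv_into) (simp add: bij_betw_def)
      then have 1: "bij_betw g (\<Union>(\<phi> ` S)) {0..t}"
        unfolding U g_def using f(1) by (rule bij_betw_trans)
      have "g ` \<phi> e = f ` e" if "e \<in> S" for e
        unfolding g_def \<phi>_def image_comp[symmetric] using inj that by (subst inv_into_image_cancel) auto
      then have "(\<lambda>e. g ` e) ` \<phi> ` S = (\<lambda>e. f ` e) ` S" by (auto simp: image_image)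
      then show "graph_iso (\<Union>(\<phi> ` S), \<phi> ` S) (star t)"
        unfolding graph_iso_def using 1 f(2) by (intro exI[of _ g]) (simp add: star_def)
    next
      assume "graph_iso (\<Union>(\<phi> ` S), \<phi> ` S) (star t)"
      then obtain f where f: "bij_betw f (\<sigma> ` \<Union>S) {0..t}" "(\<lambda>e. f ` e) ` \<phi> ` S = edges (star t)"
        unfolding graph_iso_def U by (auto simp: star_def)
      have "bij_betw \<sigma> (\<Union>S) (\<sigma> ` \<Union>S)" using inj by (simp add: bij_betw_def)
      then have "bij_betw (f \<circ> \<sigma>) (\<Union>S) {0..t}" using f(1) by (rule bij_betw_trans)
      moreover have "(\<lambda>e. (f \<circ> \<sigma>) ` e) ` S = edges (star t)"
        using f(2) by (simp add: image_image \<phi>_def image_comp)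
      ultimately show "graph_iso (\<Union>S, S) (star t)"
        unfolding graph_iso_def by (intro exI[of _ "f \<circ> \<sigma>"]) (simp add: star_def)
    qed
  qed
  have "{S. S \<subseteq> copy H \<sigma> \<and> graph_iso (\<Union>S, S) (star t)} = (\<lambda>S. \<phi> ` S) ` stars H t"
    unfolding cp stars_def using iso by (auto simp: subset_image_iff)
  moreover have "inj_on (\<lambda>S. \<phi> ` S) (stars H t)"
    by (rule inj_on_subset[OF inj_on_image_Pow[OF injE]]) (auto simp: stars_def)
  ultimately show ?thesis by (simp add: card_image)
qed

definition nbrs :: "nat \<Rightarrow> nat set set \<Rightarrow> nat \<Rightarrow> nat set" where
  "nbrs n E u = {l \<in> {1..n} - {u}. {u, l} \<in> E}"

lemma finite_nbrs: "finite (nbrs n E u)" by (simp add: nbrs_def)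

text \<open>
  Vertices outside the copy have degree zero, whence the condition on \<open>\<phi> 0\<close>.
\<close>

lemma sum_degrees_copy:
  fixes \<phi> :: "nat \<Rightarrow> real"
  assumes H: "simple_graph H" and s: "\<sigma> \<in> embeddings n H" and "\<phi> 0 = 0"
  shows "(\<Sum>u\<in>{1..n}. \<phi> (card (nbrs n (copy H \<sigma>) u))) = (\<Sum>w\<in>verts H. \<phi> (deg H w))"
proof -
  have V: "finite (verts H)" and E: "edges H \<subseteq> pairs (verts H)" using H by (auto simp: simple_graph_def)
  have inj: "inj_on \<sigma> (verts H)" and mem: "\<And>w. w \<in> verts H \<Longrightarrow> \<sigma> w \<in> {1..n}"
    using s by (auto simp: embeddings_def PiE_iff)
  have sub: "d \<subseteq> verts H" if "d \<in> edges H" for d using E that by (auto simp: pairs_def)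
  have out: "nbrs n (copy H \<sigma>) u = {}" if "u \<notin> \<sigma> ` verts H" for u
  proof (rule ccontr)
    assume "nbrs n (copy H \<sigma>) u \<noteq> {}"
    then obtain l d where "d \<in> edges H" "{u, l} = \<sigma> ` d" by (auto simp: nbrs_def copy_def)
    then have "u \<in> \<sigma> ` d" using insertI1[of u "{l}"] by simp
    then have "u \<in> \<sigma> ` verts H" using sub[OF \<open>d \<in> edges H\<close>] by auto
    then show False using that by simp
  qed
  have in_nbrs: "nbrs n (copy H \<sigma>) (\<sigma> w) = \<sigma> ` {v \<in> verts H. {w, v} \<in> edges H}" if w: "w \<in> verts H" for w
  proof (intro equalityI subsetI)
    fix l assume l: "l \<in> nbrs n (copy H \<sigma>) (\<sigma> w)"
    then obtain d where d: "d \<in> edges H" "{\<sigma> w, l} = \<sigma> ` d" by (auto simp: nbrs_def copy_def)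
    then have "l \<in> \<sigma> ` d" by auto
    then obtain v where v: "v \<in> d" "l = \<sigma> v" by auto
    have "\<sigma> ` {w, v} = \<sigma> ` d" using d v by simp
    moreover have "{w, v} \<subseteq> verts H" using w v sub[OF d(1)] by auto
    ultimately have "{w, v} = d" using inj_on_image_eq_iff[OF inj _ sub[OF d(1)]] by metis
    then show "l \<in> \<sigma> ` {v \<in> verts H. {w, v} \<in> edges H}" using v d sub[OF d(1)] by auto
  next
    fix l assume "l \<in> \<sigma> ` {v \<in> verts H. {w, v} \<in> edges H}"
    then obtain v where v: "v \<in> verts H" "{w, v} \<in> edges H" "l = \<sigma> v" by auto
    have "card {w, v} = 2" using v(2) E by (auto simp: pairs_def)
    then have "w \<noteq> v" by auto
    then have "\<sigma> v \<noteq> \<sigma> w" using inj v(1) w by (auto dest: inj_onD)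
    moreover have "{\<sigma> w, \<sigma> v} \<in> copy H \<sigma>" unfolding copy_def using v(2) by (intro image_eqI[of _ _ "{w, v}"]) auto
    ultimately show "l \<in> nbrs n (copy H \<sigma>) (\<sigma> w)" using v mem by (auto simp: nbrs_def)
  qed
  have card_nbrs: "card (nbrs n (copy H \<sigma>) (\<sigma> w)) = deg H w" if "w \<in> verts H" for w
    unfolding in_nbrs[OF that] deg_def using inj by (intro card_image) (auto intro: inj_on_subset)
  have "(\<Sum>u\<in>{1..n}. \<phi> (card (nbrs n (copy H \<sigma>) u))) = (\<Sum>u\<in>\<sigma> ` verts H. \<phi> (card (nbrs n (copy H \<sigma>) u)))"
    using mem out \<open>\<phi> 0 = 0\<close> by (intro sum.mono_neutral_right) auto
  also have "\<dots> = (\<Sum>w\<in>verts H. \<phi> (deg H w))"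
    by (simp add: sum.reindex[OF inj] card_nbrs)
  finally show ?thesis .
qed

text \<open>
  The sum counts pairs of a centre and \<open>t\<close> of its neighbours in a copy of \<open>H\<close>, and every star arises
  from at most two pairs.
\<close>

lemma sum_binomial_degrees_le_stars:
  assumes H: "simple_graph H" "card (verts H) \<le> n" and t: "t \<ge> 1"
  shows "(\<Sum>w\<in>verts H. real (deg H w choose t)) \<le> 2 * real (card (stars H t))"
proof -
  have V: "finite (verts H)" and E: "edges H \<subseteq> pairs (verts H)" using H by (auto simp: simple_graph_def)
  obtain \<sigma> where s: "\<sigma> \<in> embeddings n H" using card_embeddings_pos[OF V H(2)] by (metis all_not_in_conv card.empty less_irrefl)
  then have inj: "inj_on \<sigma> (verts H)" by (simp add: embeddings_def)
  let ?E = "copy H \<sigma>"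
  let ?J = "SIGMA u:{1..n}. {L. L \<subseteq> nbrs n ?E u \<and> card L = t}"
  let ?T = "{S. S \<subseteq> ?E \<and> graph_iso (\<Union>S, S) (star t)}"
  have finE: "finite ?E" unfolding copy_def using E V finite_subset finite_pairs by blast
  have finT: "finite ?T" by (rule finite_subset[of _ "Pow ?E"]) (use finE in auto)
  have finJ: "finite ?J" using finite_nbrs by (intro finite_SigmaI) auto
  have "(\<Sum>w\<in>verts H. real (deg H w choose t)) = (\<Sum>u\<in>{1..n}. real (card (nbrs n ?E u) choose t))"
    using t by (intro sum_degrees_copy[symmetric] H s) auto
  also have "\<dots> = real (card ?J)" using finite_nbrs by (simp add: n_subsets)
  also have "card ?J \<le> (\<Sum>S\<in>?T. card {(u, L) \<in> ?J. star_at u L = S})"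
  proof -
    have "?J \<subseteq> (\<Union>S\<in>?T. {(u, L) \<in> ?J. star_at u L = S})"
    proof
      fix x assume x: "x \<in> ?J"
      obtain u L where uL: "x = (u, L)" by (cases x)
      then have L: "L \<subseteq> nbrs n ?E u" "card L = t" using x by auto
      then have "star_at u L \<subseteq> ?E" "u \<notin> L" by (auto simp: star_at_def nbrs_def)
      then have "star_at u L \<in> ?T" using t star_at_iso_star[OF _ L(2) t] by simp
      then show "x \<in> (\<Union>S\<in>?T. {(u, L) \<in> ?J. star_at u L = S})" using x uL by auto
    qed
    then have "card ?J \<le> card (\<Union>S\<in>?T. {(u, L) \<in> ?J. star_at u L = S})"
      by (rule card_mono[rotated]) (intro finite_UN_I[OF finT] finite_subset[OF _ finJ], auto)
    also have "\<dots> \<le> (\<Sum>S\<in>?T. card {(u, L) \<in> ?J. star_at u L = S})" by (rule card_UN_le[OF finT])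
    finally show ?thesis .
  qed
  also have "\<dots> \<le> (\<Sum>S\<in>?T. 2)"
  proof (rule sum_mono)
    fix S assume S: "S \<in> ?T"
    have two: "card e = 2" if "e \<in> S" for e
    proof -
      obtain d where "d \<in> edges H" "e = \<sigma> ` d" using S \<open>e \<in> S\<close> by (auto simp: copy_def)
      moreover from this have "card d = 2" "d \<subseteq> verts H" using E by (auto simp: pairs_def)
      ultimately show ?thesis using inj by (metis card_image inj_on_subset)
    qed
    have iso: "graph_iso (\<Union>S, S) (star t)" using S by simp
    obtain u L where uL: "S = star_at u L" "u \<notin> L" "card L = t" "u \<in> \<Union>S" "L \<subseteq> \<Union>S"
      by (rule iso_star_obtains[OF iso two])
    then show "card {(u, L) \<in> ?J. star_at u L = S} \<le> 2"
      using t by (intro card_star_representations_le) (auto simp: nbrs_def)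
  qed
  also have "\<dots> = 2 * card (stars H t)"
    by (simp add: card_stars_copy[OF H(1) inj])
  finally show ?thesis by simp
qed

text \<open>
  The summand \<open>1\<close> covers degrees below \<open>t\<close>, which carry no star with \<open>t\<close> edges.
\<close>

lemma degree_power_le_binomial:
  assumes "t \<ge> 1"
  shows "real d ^ t \<le> real t ^ t * (real (d choose t) + 1)"
proof (cases "t \<le> d")
  case True
  then have "(real d / real t) ^ t \<le> real (d choose t)" by (rule binomial_ge_n_over_k_pow_k)
  then have "real d ^ t \<le> real t ^ t * real (d choose t)" using assms by (simp add: power_divide field_simps)
  then show ?thesis by (simp add: algebra_simps add_increasing)
next
  case False
  then have "real d ^ t \<le> real t ^ t" by (intro power_mono) auto
  then show ?thesis using False by (simp add: binomial_eq_0)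
qed

section \<open>Fluctuations of the signed star count given the planted copy\<close>

text \<open>
  Below the threshold \<open>K\<close> the first term dominates; above it, each of the missing squares is worth
  at least a factor \<open>K\<^sup>2\<close>. This is what makes partially planted stars negligible: lower moments are
  controlled by the moment of order \<open>t\<close> itself.
\<close>

lemma even_power_split_bound:
  fixes x K :: real
  assumes "0 \<le> x" "1 \<le> K" "s < t"
  shows "x ^ (2 * s) \<le> K ^ (2 * t) + x ^ (2 * t) / K\<^sup>2"
proof (cases "x \<le> K")
  case True
  then have "x ^ (2 * s) \<le> K ^ (2 * s)" using assms by (intro power_mono) auto
  also have "\<dots> \<le> K ^ (2 * t)" using assms by (intro power_increasing) auto
  also have "\<dots> \<le> K ^ (2 * t) + x ^ (2 * t) / K\<^sup>2" using assms by simp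
  finally show ?thesis .
next
  case False
  have "x ^ (2 * s) * K\<^sup>2 \<le> x ^ (2 * s) * x\<^sup>2"
    using False assms by (intro mult_left_mono power_mono) auto
  also have "\<dots> = x ^ (2 * s + 2)" by (simp only: power_add)
  also have "\<dots> \<le> x ^ (2 * t)" using False assms by (intro power_increasing) auto
  finally have "x ^ (2 * s) \<le> x ^ (2 * t) / K\<^sup>2" using assms by (simp add: pos_le_divide_eq)
  also have "\<dots> \<le> K ^ (2 * t) + x ^ (2 * t) / K\<^sup>2" using assms by simp
  finally show ?thesis .
qed

text \<open>
  The sum over the possible sets \<open>M\<close> of unplanted leaves of one centre, with \<open>x\<close> the signal times the
  planted degree of that centre. The empty set is excluded because it belongs to the conditional mean.
\<close>

lemma leaf_set_sum_le:
  fixes x :: real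
  assumes n: "n > 0" and x: "0 \<le> x" and K: "1 \<le> K"
  shows "(\<Sum>M | M \<subseteq> {1..n} \<and> 1 \<le> card M \<and> card M \<le> t. x ^ (2 * (t - card M)))
    \<le> t * real n ^ t * (K ^ (2 * t) + (x / sqrt n) ^ (2 * t) / K\<^sup>2)"
proof -
  let ?A = "{M. M \<subseteq> {1..n} \<and> 1 \<le> card M \<and> card M \<le> t}"
  let ?c = "K ^ (2 * t) + (x / sqrt n) ^ (2 * t) / K\<^sup>2"
  have fin: "finite ?A" by (rule finite_subset[of _ "Pow {1..n}"]) auto
  have "(\<Sum>M\<in>?A. x ^ (2 * (t - card M))) = (\<Sum>r\<in>{1..t}. \<Sum>M\<in>{M\<in>?A. card M = r}. x ^ (2 * (t - card M)))"
    by (rule sum.group[symmetric, OF fin]) auto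
  also have "\<dots> \<le> (\<Sum>r\<in>{1..t}. real n ^ t * ?c)"
  proof (rule sum_mono)
    fix r assume r: "r \<in> {1..t}"
    have "{M\<in>?A. card M = r} = {M. M \<subseteq> {1..n} \<and> card M = r}" using r by auto
    then have c: "card {M\<in>?A. card M = r} = n choose r" by (simp add: n_subsets)
    have "(\<Sum>M\<in>{M\<in>?A. card M = r}. x ^ (2 * (t - card M))) = real (n choose r) * x ^ (2 * (t - r))"
      by (simp add: c[symmetric])
    also have "\<dots> \<le> real n ^ r * x ^ (2 * (t - r))"
      using binomial_le_power[of n r] x by (intro mult_right_mono) (simp_all flip: of_nat_power)
    also have "\<dots> = real n ^ r * (real n ^ (t - r) * (x / sqrt n) ^ (2 * (t - r)))"
    proof -
      have "sqrt n ^ (2 * (t - r)) = real n ^ (t - r)" by (simp add: power_mult)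
      then show ?thesis using n by (simp add: power_divide)
    qed
    also have "\<dots> = real n ^ t * (x / sqrt n) ^ (2 * (t - r))"
      using r by (simp flip: mult.assoc power_add)
    also have "\<dots> \<le> real n ^ t * ?c"
      using r x K by (intro mult_left_mono even_power_split_bound) auto
    finally show "(\<Sum>M\<in>{M\<in>?A. card M = r}. x ^ (2 * (t - card M))) \<le> real n ^ t * ?c" .
  qed
  also have "\<dots> = t * real n ^ t * ?c" by simp
  finally show ?thesis .
qed

text \<open>
  Choose a centre for every star. A star \<open>S\<close> that is not fully planted contributes a multiple of the
  character on its unplanted edges, which is again a star with the same centre and the unplanted
  leaves \<open>M\<close>. For a given centre \<open>u\<close> and \<open>M\<close>, the planted leaves are \<open>t - card M\<close> neighbours of \<open>u\<close>
  in \<open>E\<close>, so the coefficient of this character is at most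
  \<open>(edge_signal p * degree) ^ (t - card M)\<close>. The fully planted stars make up exactly the subtracted
  mean.
\<close>

lemma planted_star_fluctuation_le:
  assumes n: "n > 0" and p: "0 < p" "p < 1" and E: "E \<subseteq> pairs {1..n}" and t: "t \<ge> 1" and K: "1 \<le> K"
  shows "measure_pmf.expectation (gnp n p) (\<lambda>G. (signed_count n p (star t) (plant E G)
      - edge_signal p ^ t * card {S. S \<subseteq> E \<and> graph_iso (\<Union>S, S) (star t)})\<^sup>2)
    \<le> 2 * (\<Sum>u\<in>{1..n}. t * real n ^ t * (K ^ (2 * t) + (edge_signal p * card (nbrs n E u) / sqrt n) ^ (2 * t) / K\<^sup>2))"
proof -
  let ?St = "{S. S \<subseteq> pairs {1..n} \<and> graph_iso (\<Union>S, S) (star t)}"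
  let ?C = "centred_stars {1..n} t"
  let ?f = "\<lambda>(u, L). star_at u L"
  have St: "?St = ?f ` ?C" by (rule stars_complete_eq[OF t])
  have finSt: "finite ?St" unfolding St using finite_centred_stars by blast
  have l0: "edge_signal p \<ge> 0" using edge_signal_nonneg p by simp
  define ctr where "ctr = (\<lambda>S. fst (inv_into ?C ?f S))"
  define lv where "lv = (\<lambda>S. snd (inv_into ?C ?f S))"
  have uL: "ctr S \<in> {1..n}" "lv S \<subseteq> {1..n} - {ctr S}" "card (lv S) = t" "S = star_at (ctr S) (lv S)" if "S \<in> ?St" for S
  proof -
    have "S \<in> ?f ` ?C" using that by (simp only: St)
    then have "inv_into ?C ?f S \<in> ?C" "?f (inv_into ?C ?f S) = S" by (rule inv_into_into, rule f_inv_into_f)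
    then show "ctr S \<in> {1..n}" "lv S \<subseteq> {1..n} - {ctr S}" "card (lv S) = t" "S = star_at (ctr S) (lv S)"
      unfolding ctr_def lv_def centred_stars_def by (auto simp: case_prod_beta)
  qed
  define out where "out = (\<lambda>S. {l \<in> lv S. {ctr S, l} \<notin> E})"
  define \<pi> where "\<pi> = (\<lambda>S. (ctr S, out S))"
  have finS: "finite S" if "S \<in> ?St" for S using that finite_pairs[of "{1..n}"] finite_subset by auto
  have cardS: "card S = t" if "S \<in> ?St" for S
  proof -
    have "card S = card (star_at (ctr S) (lv S))" by (rule arg_cong[OF uL(4)[OF that]])
    also have "\<dots> = card (lv S)" using uL(2)[OF that] by (intro card_star_at) auto
    finally show ?thesis using uL(3)[OF that] by simp
  qed
  have star_diff: "star_at u L - E = star_at u {l \<in> L. {u, l} \<notin> E}" for u :: nat and L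
    by (auto simp: star_at_def)
  have diff: "S - E = star_at (ctr S) (out S)" if "S \<in> ?St" for S
    unfolding out_def by (rule trans[OF arg_cong[OF uL(4)[OF that], of "\<lambda>X. X - E"] star_diff])
  have ctr_out: "ctr S \<notin> out S" if "S \<in> ?St" for S using uL(2)[OF that] by (auto simp: out_def)
  have cap: "card (S \<inter> E) = t - card (out S)" if "S \<in> ?St" for S
    using card_Diff_subset_Int[of S E] finS[OF that] cardS[OF that] diff[OF that] card_star_at[OF ctr_out[OF that]]
      card_mono[OF finS[OF that], of "S \<inter> E"] by auto
  define B where "B = {S \<in> ?St. \<not> S \<subseteq> E}"
  define J where "J = \<pi> ` B"
  have finB: "finite B" unfolding B_def by (rule finite_subset[OF _ finSt]) auto
  have finA: "finite {S \<in> ?St. S \<subseteq> E}" by (rule finite_subset[OF _ finSt]) auto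
  have finJ: "finite J" unfolding J_def using finB by simp
  \<comment> \<open>Coefficient collected by the character of the star with centre and leaf set \<open>j\<close>.\<close>
  define a where "a = (\<lambda>j. \<Sum>S\<in>{S\<in>B. \<pi> S = j}. edge_signal p ^ card (S \<inter> E))"
  have Jmem: "u \<in> {1..n} \<and> M \<subseteq> {1..n} - {u} \<and> M \<noteq> {} \<and> card M \<le> t" if "(u, M) \<in> J" for u M
  proof -
    obtain S where S: "S \<in> ?St" "\<not> S \<subseteq> E" "u = ctr S" "M = out S"
      using \<open>(u, M) \<in> J\<close> unfolding J_def B_def \<pi>_def by auto
    have "M \<subseteq> lv S" using S(4) by (auto simp: out_def)
    moreover have "finite (lv S)" using uL(2)[OF S(1)] finite_subset by blast
    ultimately have "card M \<le> t" using uL(3)[OF S(1)] card_mono by metis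
    moreover have "M \<noteq> {}" using diff[OF S(1)] S by (auto simp: star_at_def)
    ultimately show ?thesis using uL[OF S(1)] S(3) \<open>M \<subseteq> lv S\<close> by auto
  qed
  have chi_split: "signed_count n p (star t) (plant E G) - edge_signal p ^ t * card {S. S \<subseteq> E \<and> graph_iso (\<Union>S, S) (star t)}
     = (\<Sum>j\<in>J. a j * chi p (?f j) G)" for G
  proof -
    have eq: "{S\<in>?St. S \<subseteq> E} = {S. S \<subseteq> E \<and> graph_iso (\<Union>S, S) (star t)}" using E by auto
    have "signed_count n p (star t) (plant E G) = (\<Sum>S\<in>?St. edge_signal p ^ card (S \<inter> E) * chi p (S - E) G)"
      unfolding signed_count_def using chi_plant[OF p finS] by (intro sum.cong) auto
    also have "\<dots> = (\<Sum>S\<in>{S\<in>?St. S \<subseteq> E}. edge_signal p ^ card (S \<inter> E) * chi p (S - E) G)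
        + (\<Sum>S\<in>B. edge_signal p ^ card (S \<inter> E) * chi p (S - E) G)"
    proof -
      have "?St = {S\<in>?St. S \<subseteq> E} \<union> B" unfolding B_def by blast
      moreover have "{S\<in>?St. S \<subseteq> E} \<inter> B = {}" unfolding B_def by blast
      ultimately show ?thesis by (metis (no_types, lifting) sum.union_disjoint[OF finA finB])
    qed
    also have "(\<Sum>S\<in>{S\<in>?St. S \<subseteq> E}. edge_signal p ^ card (S \<inter> E) * chi p (S - E) G) = (\<Sum>S\<in>{S\<in>?St. S \<subseteq> E}. edge_signal p ^ t)"
    proof (rule sum.cong[OF refl])
      fix S assume "S \<in> {S\<in>?St. S \<subseteq> E}"
      then have "S \<inter> E = S" "S - E = {}" "card S = t" using cardS by auto
      then show "edge_signal p ^ card (S \<inter> E) * chi p (S - E) G = edge_signal p ^ t" by (simp only: chi_def prod.empty mult_1_right)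
    qed
    also have "\<dots> = edge_signal p ^ t * card {S. S \<subseteq> E \<and> graph_iso (\<Union>S, S) (star t)}"
      by (simp only: eq sum_constant mult.commute)
    finally have 1: "signed_count n p (star t) (plant E G) - edge_signal p ^ t * card {S. S \<subseteq> E \<and> graph_iso (\<Union>S, S) (star t)}
      = (\<Sum>S\<in>B. edge_signal p ^ card (S \<inter> E) * chi p (S - E) G)"
      by (simp only: add_diff_cancel_left')
    also have "\<dots> = (\<Sum>j\<in>J. \<Sum>S\<in>{S\<in>B. \<pi> S = j}. edge_signal p ^ card (S \<inter> E) * chi p (S - E) G)"
      by (rule sum.group[symmetric, OF finB finJ]) (simp add: J_def)
    also have "\<dots> = (\<Sum>j\<in>J. a j * chi p (?f j) G)"
      unfolding a_def sum_distrib_right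
      by (intro sum.cong refl) (use diff in \<open>auto simp: B_def \<pi>_def\<close>)
    finally show ?thesis .
  qed
  \<comment> \<open>The stars collected in this coefficient differ only in their planted leaves, a subset of \<open>nbrs n E u\<close>.\<close>
  have a_bound: "(a (u, M))\<^sup>2 \<le> (edge_signal p * card (nbrs n E u)) ^ (2 * (t - card M))" if uM: "(u, M) \<in> J" for u M
  proof -
    let ?F = "{S\<in>B. \<pi> S = (u, M)}"
    let ?k = "t - card M"
    have F: "S \<in> ?St" "ctr S = u" "out S = M" if "S \<in> ?F" for S using that by (auto simp: B_def \<pi>_def)
    have "a (u, M) = (\<Sum>S\<in>?F. edge_signal p ^ ?k)"
      unfolding a_def using cap F by (intro sum.cong) auto
    then have a_eq: "a (u, M) = real (card ?F) * edge_signal p ^ ?k" by simp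
    have "card ?F \<le> card {X. X \<subseteq> nbrs n E u \<and> card X = ?k}"
    proof (rule card_inj_on_le)
      show "inj_on (\<lambda>S. lv S - M) ?F"
      proof (rule inj_onI)
        fix S S' assume S: "S \<in> ?F" "S' \<in> ?F" and eq: "lv S - M = lv S' - M"
        have "M \<subseteq> lv S" "M \<subseteq> lv S'" using F(3)[OF S(1)] F(3)[OF S(2)] by (auto simp: out_def)
        then have "lv S = lv S'" using eq by blast
        then show "S = S'" using uL(4)[OF F(1)[OF S(1)]] uL(4)[OF F(1)[OF S(2)]] F(2) S by metis
      qed
      show "(\<lambda>S. lv S - M) ` ?F \<subseteq> {X. X \<subseteq> nbrs n E u \<and> card X = ?k}"
      proof (rule image_subsetI)
        fix S assume S: "S \<in> ?F"
        note S' = F[OF S]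
        have M: "M \<subseteq> lv S" using S'(3) by (auto simp: out_def)
        have "finite (lv S)" using uL(2)[OF S'(1)] finite_subset by blast
        then have "card (lv S - M) = ?k" using M uL(3)[OF S'(1)] by (metis card_Diff_subset finite_subset)
        moreover have "lv S - M \<subseteq> nbrs n E u"
          using uL(2)[OF S'(1)] S'(2,3) by (auto simp: out_def nbrs_def)
        ultimately show "lv S - M \<in> {X. X \<subseteq> nbrs n E u \<and> card X = ?k}" by simp
      qed
      show "finite {X. X \<subseteq> nbrs n E u \<and> card X = ?k}"
        by (rule finite_subset[of _ "Pow (nbrs n E u)"]) (use finite_nbrs in auto)
    qed
    also have "\<dots> = card (nbrs n E u) choose ?k" using finite_nbrs by (simp add: n_subsets)
    also have "\<dots> \<le> card (nbrs n E u) ^ ?k" by (rule binomial_le_power)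
    finally have "real (card ?F) \<le> real (card (nbrs n E u) ^ ?k)" by (simp only: of_nat_le_iff)
    then have "a (u, M) \<le> real (card (nbrs n E u)) ^ ?k * edge_signal p ^ ?k"
      unfolding a_eq using l0 by (intro mult_right_mono) auto
    also have "\<dots> = (edge_signal p * card (nbrs n E u)) ^ ?k" by (simp add: power_mult_distrib mult.commute)
    finally have "a (u, M) \<le> (edge_signal p * card (nbrs n E u)) ^ ?k" .
    moreover have "0 \<le> a (u, M)" unfolding a_eq using l0 by simp
    ultimately have "(a (u, M))\<^sup>2 \<le> ((edge_signal p * card (nbrs n E u)) ^ ?k)\<^sup>2" by (intro power_mono)
    also have "\<dots> = (edge_signal p * card (nbrs n E u)) ^ (2 * ?k)" by (simp only: power_mult[symmetric] mult.commute)
    finally show ?thesis .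
  qed
  let ?U = "SIGMA u:{1..n}. {M. M \<subseteq> {1..n} \<and> 1 \<le> card M \<and> card M \<le> t}"
  have finU: "finite ?U"
    by (rule finite_subset[of _ "{1..n} \<times> Pow {1..n}"]) auto
  have JU: "J \<subseteq> ?U"
  proof
    fix j assume j: "j \<in> J"
    obtain u M where uM: "j = (u, M)" by (cases j)
    then have m: "u \<in> {1..n} \<and> M \<subseteq> {1..n} - {u} \<and> M \<noteq> {} \<and> card M \<le> t" using Jmem j by simp
    then have "finite M" using finite_subset[of M "{1..n}"] by auto
    then have "1 \<le> card M" using m by (simp add: Suc_le_eq card_gt_0_iff)
    then show "j \<in> ?U" using m uM by auto
  qed
  have "measure_pmf.expectation (gnp n p) (\<lambda>G. (signed_count n p (star t) (plant E G)
      - edge_signal p ^ t * card {S. S \<subseteq> E \<and> graph_iso (\<Union>S, S) (star t)})\<^sup>2)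
    = measure_pmf.expectation (gnp n p) (\<lambda>G. (\<Sum>j\<in>J. a j * chi p (?f j) G)\<^sup>2)"
    by (simp only: chi_split)
  also have "\<dots> \<le> real 2 * (\<Sum>j\<in>J. (a j)\<^sup>2)"
  proof (rule second_moment_le_multiplicity[OF p finJ])
    show "?f j \<subseteq> pairs {1..n}" if j: "j \<in> J" for j
    proof -
      obtain u M where uM: "j = (u, M)" by (cases j)
      then have "u \<in> {1..n}" "M \<subseteq> {1..n} - {u}" using Jmem[of u M] j by auto
      then show ?thesis using star_at_subset_pairs[of u "{1..n}" M] by (simp only: uM case_prod_conv)
    qed
    fix j assume j: "j \<in> J"
    obtain u M where uM: "j = (u, M)" by (cases j)
    then have m: "u \<notin> M" "M \<noteq> {}" using Jmem[of u M] j by auto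
    have "card {(v, M) \<in> J. star_at v M = ?f j} \<le> 2"
      using m Jmem uM by (intro card_star_representations_le[of _ u M]) auto
    then show "card {i \<in> J. ?f i = ?f j} \<le> 2" by (simp add: case_prod_beta')
  qed
  also have "(\<Sum>j\<in>J. (a j)\<^sup>2) \<le> (\<Sum>j\<in>J. (\<lambda>(u, M). (edge_signal p * card (nbrs n E u)) ^ (2 * (t - card M))) j)"
    using a_bound by (intro sum_mono) auto
  also have "\<dots> \<le> (\<Sum>j\<in>?U. (\<lambda>(u, M). (edge_signal p * card (nbrs n E u)) ^ (2 * (t - card M))) j)"
    using l0 by (intro sum_mono2[OF finU JU]) auto
  also have "\<dots> = (\<Sum>u\<in>{1..n}. \<Sum>M | M \<subseteq> {1..n} \<and> 1 \<le> card M \<and> card M \<le> t. (edge_signal p * card (nbrs n E u)) ^ (2 * (t - card M)))"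
    by (rule sum.Sigma[symmetric]) (auto intro: finite_subset[of _ "Pow {1..n}"])
  also have "\<dots> \<le> (\<Sum>u\<in>{1..n}. t * real n ^ t * (K ^ (2 * t) + (edge_signal p * card (nbrs n E u) / sqrt n) ^ (2 * t) / K\<^sup>2))"
    using n l0 K by (intro sum_mono leaf_set_sum_le) auto
  finally show ?thesis by simp
qed

section \<open>Mean and variance of the signed star count\<close>

lemma sum_squares_le_square_sum:
  fixes a :: "'a \<Rightarrow> real"
  assumes "finite I" "\<And>i. i \<in> I \<Longrightarrow> 0 \<le> a i"
  shows "(\<Sum>i\<in>I. (a i)\<^sup>2) \<le> (\<Sum>i\<in>I. a i)\<^sup>2"
proof -
  have "(\<Sum>i\<in>I. (a i)\<^sup>2) \<le> (\<Sum>i\<in>I. a i * (\<Sum>j\<in>I. a j))"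
    unfolding power2_eq_square using assms by (intro sum_mono mult_left_mono member_le_sum) auto
  then show ?thesis by (simp add: power2_eq_square sum_distrib_right)
qed

lemma copy_subset_pairs:
  assumes H: "simple_graph H" and s: "\<sigma> \<in> embeddings n H"
  shows "copy H \<sigma> \<subseteq> pairs {1..n}"
proof
  fix e assume "e \<in> copy H \<sigma>"
  then obtain d where d: "d \<in> edges H" "e = \<sigma> ` d" by (auto simp: copy_def)
  have dV: "d \<subseteq> verts H" "card d = 2" using H d(1) by (auto simp: simple_graph_def pairs_def)
  have "inj_on \<sigma> d" using s dV(1) by (auto simp: embeddings_def intro: inj_on_subset)
  moreover have "\<sigma> ` d \<subseteq> {1..n}" using s dV(1) by (auto simp: embeddings_def PiE_iff)
  ultimately show "e \<in> pairs {1..n}" using d dV by (simp add: pairs_def card_image)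
qed

lemma expectation_gnp_signed_star:
  assumes p: "0 < p" "p < 1" and t: "t \<ge> 1"
  shows "measure_pmf.expectation (gnp n p) (signed_count n p (star t)) = 0"
    and "measure_pmf.expectation (gnp n p) (\<lambda>G. (signed_count n p (star t) G)\<^sup>2)
      = card {S. S \<subseteq> pairs {1..n} \<and> graph_iso (\<Union>S, S) (star t)}"
    and "measure_pmf.expectation (gnp n p) (\<lambda>G. (signed_count n p (star t) G)\<^sup>2) \<le> real n ^ Suc t"
proof -
  let ?St = "{S. S \<subseteq> pairs {1..n} \<and> graph_iso (\<Union>S, S) (star t)}"
  have St: "?St = (\<lambda>(u, L). star_at u L) ` centred_stars {1..n} t" by (rule stars_complete_eq[OF t])
  have finC: "finite (centred_stars {1..n} t)" by (simp add: finite_centred_stars)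
  have finSt: "finite ?St" unfolding St using finC by (rule finite_imageI)
  have ne: "S \<noteq> {}" if "S \<in> ?St" for S
  proof -
    have "S \<in> (\<lambda>(u, L). star_at u L) ` centred_stars {1..n} t" using that unfolding St .
    then show ?thesis using t by (auto simp: centred_stars_def star_at_def)
  qed
  have "measure_pmf.expectation (gnp n p) (\<lambda>G. \<Sum>S\<in>?St. chi p S G)
     = (\<Sum>S\<in>?St. measure_pmf.expectation (gnp n p) (chi p S))"
    by (rule Bochner_Integration.integral_sum) (rule integrable_gnp)
  also have "\<dots> = (\<Sum>S\<in>?St. 0)"
    using ne expectation_gnp_chi[OF p] by (intro sum.cong) auto
  finally show "measure_pmf.expectation (gnp n p) (signed_count n p (star t)) = 0"
    by (simp add: signed_count_def[abs_def])
  have "measure_pmf.expectation (gnp n p) (\<lambda>G. (\<Sum>S\<in>?St. 1 * chi p S G)\<^sup>2) = (\<Sum>S\<in>?St. 1\<^sup>2)"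
    by (rule parseval_chi[OF p finSt]) auto
  then show Q2: "measure_pmf.expectation (gnp n p) (\<lambda>G. (signed_count n p (star t) G)\<^sup>2) = real (card ?St)"
    by (simp add: signed_count_def)
  have "card ?St \<le> card (centred_stars {1..n} t)" unfolding St by (rule card_image_le[OF finC])
  also have "\<dots> \<le> n ^ Suc t" by (rule card_centred_stars_le)
  finally show "measure_pmf.expectation (gnp n p) (\<lambda>G. (signed_count n p (star t) G)\<^sup>2) \<le> real n ^ Suc t"
    unfolding Q2 of_nat_power[symmetric] of_nat_le_iff .
qed

lemma expectation_planted_signed_star:
  assumes H: "simple_graph H" "card (verts H) \<le> n" and p: "0 < p" "p < 1"
  shows "measure_pmf.expectation (planted n p H) (signed_count n p (star t)) = edge_signal p ^ t * card (stars H t)"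
proof -
  have V: "finite (verts H)" using H by (auto simp: simple_graph_def)
  let ?St = "{S. S \<subseteq> pairs {1..n} \<and> graph_iso (\<Union>S, S) (star t)}"
  have finSt: "finite ?St"
    by (rule finite_subset[of _ "Pow (pairs {1..n})"]) (use finite_pairs in auto)
  have cardS: "card S = t" if "S \<in> ?St" for S
  proof -
    have iso: "graph_iso (\<Union>S, S) (star t)" and two: "\<And>e. e \<in> S \<Longrightarrow> card e = 2" using that by (auto simp: pairs_def)
    obtain u L where uL: "S = star_at u L" "u \<notin> L" "card L = t" "u \<in> \<Union>S" "L \<subseteq> \<Union>S"
      by (rule iso_star_obtains[OF iso two])
    then show ?thesis using card_star_at[of u L] by simp
  qed
  have "measure_pmf.expectation (gnp n p) (\<lambda>G. signed_count n p (star t) (plant (copy H \<sigma>) G)) = edge_signal p ^ t * card (stars H t)"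
    if s: "\<sigma> \<in> embeddings n H" for \<sigma>
  proof -
    have inj: "inj_on \<sigma> (verts H)" using s by (simp add: embeddings_def)
    have eq: "?St \<inter> {S. S \<subseteq> copy H \<sigma>} = {S. S \<subseteq> copy H \<sigma> \<and> graph_iso (\<Union>S, S) (star t)}"
      using copy_subset_pairs[OF H(1) s] by blast
    have "measure_pmf.expectation (gnp n p) (\<lambda>G. signed_count n p (star t) (plant (copy H \<sigma>) G))
      = (\<Sum>S\<in>?St. measure_pmf.expectation (gnp n p) (\<lambda>G. chi p S (plant (copy H \<sigma>) G)))"
      unfolding signed_count_def by (rule Bochner_Integration.integral_sum) (rule integrable_gnp)
    also have "\<dots> = (\<Sum>S\<in>?St. edge_signal p ^ t * of_bool (S \<subseteq> copy H \<sigma>))"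
      using cardS expectation_gnp_chi_plant[OF p] by (intro sum.cong refl) auto
    also have "\<dots> = edge_signal p ^ t * (\<Sum>S\<in>?St. of_bool (S \<subseteq> copy H \<sigma>))"
      by (rule sum_distrib_left[symmetric])
    also have "(\<Sum>S\<in>?St. of_bool (S \<subseteq> copy H \<sigma>)) = real (card (?St \<inter> {S. S \<subseteq> copy H \<sigma>}))"
      by (intro sum_of_bool_eq finSt)
    also have "\<dots> = real (card (stars H t))" by (simp only: eq card_stars_copy[OF H(1) inj])
    finally show ?thesis .
  qed
  then show ?thesis
    using card_embeddings_pos[OF V H(2)] by (simp add: expectation_planted[OF V H(2)])
qed

text \<open>
  The conditional mean is the same for all embeddings, so the planted variance is the average of the
  conditional variances. The sum of \<open>x\<^sub>u ^ (2 * t)\<close> over all vertices is bounded by the square of the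
  sum of \<open>x\<^sub>u ^ t\<close>, which is \<open>sqrt n\<close> times the star moment.
\<close>

lemma variance_planted_signed_star_le:
  assumes H: "simple_graph H" "card (verts H) \<le> n" and p: "0 < p" "p < 1"
    and n: "n > 0" and t: "t \<ge> 1" and K: "1 \<le> K"
  shows "measure_pmf.variance (planted n p H) (signed_count n p (star t))
    \<le> 2 * real t * real n ^ Suc t * (K ^ (2 * t) + (star_moment n p H t)\<^sup>2 / K\<^sup>2)"
proof -
  have V: "finite (verts H)" using H by (auto simp: simple_graph_def)
  have l0: "edge_signal p \<ge> 0" using edge_signal_nonneg p by simp
  let ?b = "2 * real t * real n ^ Suc t * (K ^ (2 * t) + (star_moment n p H t)\<^sup>2 / K\<^sup>2)"
  have each: "measure_pmf.expectation (gnp n p) (\<lambda>G. (signed_count n p (star t) (plant (copy H \<sigma>) G) - edge_signal p ^ t * card (stars H t))\<^sup>2) \<le> ?b"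
    if s: "\<sigma> \<in> embeddings n H" for \<sigma>
  proof -
    have inj: "inj_on \<sigma> (verts H)" using s by (simp add: embeddings_def)
    define x where "x = (\<lambda>u. edge_signal p * card (nbrs n (copy H \<sigma>) u) / sqrt n)"
    have x0: "x u \<ge> 0" for u using l0 by (simp add: x_def)
    have "(\<Sum>u\<in>{1..n}. x u ^ t) = (\<Sum>w\<in>verts H. (edge_signal p * deg H w / sqrt n) ^ t)"
      unfolding x_def using t by (intro sum_degrees_copy[OF H(1) s]) auto
    also have "\<dots> = star_moment n p H t * sqrt n" using n by (simp add: star_moment_def)
    finally have sumx: "(\<Sum>u\<in>{1..n}. x u ^ t) = star_moment n p H t * sqrt n" .
    have "(\<Sum>u\<in>{1..n}. x u ^ (2 * t)) = (\<Sum>u\<in>{1..n}. (x u ^ t)\<^sup>2)"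
      by (simp only: power_mult[symmetric] mult.commute)
    also have "\<dots> \<le> (\<Sum>u\<in>{1..n}. x u ^ t)\<^sup>2" using x0 by (intro sum_squares_le_square_sum) auto
    also have "\<dots> = (star_moment n p H t)\<^sup>2 * n" unfolding sumx by (simp add: power_mult_distrib)
    finally have sumx2: "(\<Sum>u\<in>{1..n}. x u ^ (2 * t)) \<le> (star_moment n p H t)\<^sup>2 * n" .
    have "measure_pmf.expectation (gnp n p) (\<lambda>G. (signed_count n p (star t) (plant (copy H \<sigma>) G) - edge_signal p ^ t * card (stars H t))\<^sup>2)
      \<le> 2 * (\<Sum>u\<in>{1..n}. t * real n ^ t * (K ^ (2 * t) + x u ^ (2 * t) / K\<^sup>2))"
      unfolding card_stars_copy[OF H(1) inj, symmetric] x_def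
      by (rule planted_star_fluctuation_le[OF n p copy_subset_pairs[OF H(1) s] t K])
    also have "\<dots> = 2 * (t * real n ^ t * (n * K ^ (2 * t) + (\<Sum>u\<in>{1..n}. x u ^ (2 * t)) / K\<^sup>2))"
      by (simp add: sum.distrib sum_divide_distrib flip: sum_distrib_left)
    also have "\<dots> \<le> 2 * (t * real n ^ t * (n * K ^ (2 * t) + (star_moment n p H t)\<^sup>2 * n / K\<^sup>2))"
      using sumx2 by (intro mult_left_mono add_left_mono divide_right_mono) auto
    also have "\<dots> = ?b" by (simp add: algebra_simps)
    finally show ?thesis .
  qed
  let ?N = "card (embeddings n H)"
  have N: "?N > 0" by (rule card_embeddings_pos[OF V H(2)])
  have "measure_pmf.variance (planted n p H) (signed_count n p (star t))
     = (\<Sum>\<sigma>\<in>embeddings n H. measure_pmf.expectation (gnp n p) (\<lambda>G. (signed_count n p (star t) (plant (copy H \<sigma>) G) - edge_signal p ^ t * card (stars H t))\<^sup>2)) / ?N"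
    unfolding expectation_planted_signed_star[OF H p] by (rule expectation_planted[OF V H(2)])
  also have "\<dots> \<le> (\<Sum>\<sigma>\<in>embeddings n H. ?b) / ?N"
    by (intro divide_right_mono sum_mono each) auto
  also have "\<dots> = ?b" using N by simp
  finally show ?thesis .
qed

text \<open>
  Degrees below \<open>t\<close> are the only obstacle to replacing degree powers by star counts. They contribute
  at most \<open>n * (edge_signal p * t) ^ t\<close>, and \<open>n\<close> is below the scale \<open>sqrt n ^ Suc t\<close> because \<open>t \<ge> 1\<close>.
\<close>

lemma planted_mean_signed_star_ge:
  assumes H: "simple_graph H" "card (verts H) \<le> n" and p: "0 < p" "p < 1"
    and n: "n > 0" and t: "t \<ge> 1"
  shows "sqrt n ^ Suc t * (star_moment n p H t - (edge_signal p * t) ^ t)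
    \<le> 2 * real t ^ t * (edge_signal p ^ t * card (stars H t))"
proof -
  have l0: "edge_signal p \<ge> 0" using edge_signal_nonneg p by simp
  have "(\<Sum>w\<in>verts H. real (deg H w) ^ t) \<le> (\<Sum>w\<in>verts H. real t ^ t * (real (deg H w choose t) + 1))"
    by (intro sum_mono degree_power_le_binomial[OF t])
  also have "\<dots> = real t ^ t * ((\<Sum>w\<in>verts H. real (deg H w choose t)) + card (verts H))"
    by (simp add: sum.distrib flip: sum_distrib_left)
  also have "\<dots> \<le> real t ^ t * (2 * real (card (stars H t)) + real n)"
    using sum_binomial_degrees_le_stars[OF H t] H(2) by (intro mult_left_mono add_mono) auto
  finally have 1: "(\<Sum>w\<in>verts H. real (deg H w) ^ t) \<le> real t ^ t * (2 * real (card (stars H t)) + real n)" .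
  have "real n = sqrt n ^ 2" by simp
  also have "\<dots> \<le> sqrt n ^ Suc t" using n t by (intro power_increasing) auto
  finally have 2: "real n \<le> sqrt n ^ Suc t" .
  have "star_moment n p H t * sqrt n ^ Suc t = edge_signal p ^ t * (\<Sum>w\<in>verts H. real (deg H w) ^ t)"
    by (rule degree_power_sum_eq[OF n, symmetric])
  also have "\<dots> \<le> edge_signal p ^ t * (real t ^ t * (2 * real (card (stars H t)) + real n))"
    using l0 by (intro mult_left_mono[OF 1]) auto
  also have "\<dots> \<le> edge_signal p ^ t * (real t ^ t * (2 * real (card (stars H t)) + sqrt n ^ Suc t))"
    using l0 by (intro mult_left_mono add_left_mono 2) auto
  also have "\<dots> = 2 * real t ^ t * (edge_signal p ^ t * card (stars H t)) + (edge_signal p * t) ^ t * sqrt n ^ Suc t"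
    by (simp add: algebra_simps power_mult_distrib)
  finally show ?thesis by (simp add: algebra_simps)
qed

text \<open>
  The threshold \<open>K = Y powr (1 / Suc B)\<close> balances the two variance terms: \<open>K ^ (2 * B) = Y\<^sup>2 / K\<^sup>2\<close>.
  The planted standard deviation is then at most a constant times \<open>s * Y / K\<close> with \<open>s = sqrt n ^ Suc t\<close>,
  against a mean of at least a constant times \<open>s * Y\<close>.
\<close>

lemma star_separation_ratio_le:
  assumes H: "simple_graph H" "card (verts H) \<le> n" and p: "0 < p" "p < 1"
    and n: "n > 0" and t: "1 \<le> t" "t \<le> B" and \<Lambda>: "edge_signal p \<le> \<Lambda>" "1 \<le> \<Lambda>"
    and Y: "1 \<le> star_moment n p H t" "2 * (\<Lambda> * B) ^ B \<le> star_moment n p H t"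
  defines "P \<equiv> planted n p H" and "Q \<equiv> gnp n p" and "f \<equiv> signed_count n p (star t)"
  shows "0 < measure_pmf.expectation P f - measure_pmf.expectation Q f"
    and "max (sqrt (measure_pmf.variance P f)) (sqrt (measure_pmf.variance Q f))
       / \<bar>measure_pmf.expectation P f - measure_pmf.expectation Q f\<bar>
       \<le> 8 * real B * real B ^ B * star_moment n p H t powr (- (1 / Suc B))"
    and "star_moment n p H t / (4 * real B ^ B) \<le> adv n p H f"
proof -
  have l0: "edge_signal p \<ge> 0" using edge_signal_nonneg p by simp
  define Y where "Y = star_moment n p H t"
  define s where "s = sqrt n ^ Suc t"
  define K where "K = Y powr (1 / Suc B)"
  define \<mu> where "\<mu> = measure_pmf.expectation P f"
  have B: "1 \<le> B" using t by simp
  have Y1: "1 \<le> Y" and Y2: "2 * (\<Lambda> * B) ^ B \<le> Y" using Y by (simp_all add: Y_def)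
  have s: "s > 0" using n by (simp add: s_def)
  have s2: "s\<^sup>2 = real n ^ Suc t"
  proof -
    have "s\<^sup>2 = (sqrt n)\<^sup>2 ^ Suc t" unfolding s_def by (simp only: power_mult[symmetric] mult.commute)
    then show ?thesis by simp
  qed
  have K1: "1 \<le> K" unfolding K_def using Y1 by (simp add: ge_one_powr_ge_zero)
  have KB: "K ^ Suc B = Y" unfolding K_def using Y1 by (simp add: powr_power del: power_Suc)
  have KY: "K \<le> Y" unfolding KB[symmetric] using K1 self_le_power[of K "Suc B"] by simp
  have Bt: "real t ^ t \<le> real B ^ B"
  proof -
    have "real t ^ t \<le> real B ^ t" using t by (intro power_mono) auto
    also have "\<dots> \<le> real B ^ B" using t by (intro power_increasing) auto
    finally show ?thesis .
  qed
  have "(edge_signal p * t) ^ t \<le> (\<Lambda> * B) ^ t" using l0 \<Lambda> t by (intro power_mono mult_mono) auto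
  also have "\<dots> \<le> (\<Lambda> * B) ^ B"
    using \<Lambda> t mult_mono[of 1 \<Lambda> 1 "real B"] by (intro power_increasing) auto
  finally have "(edge_signal p * t) ^ t \<le> Y / 2" using Y2 by simp
  then have half: "Y / 2 \<le> Y - (edge_signal p * t) ^ t" by simp
  have mu: "\<mu> = edge_signal p ^ t * card (stars H t)"
    unfolding \<mu>_def P_def f_def by (rule expectation_planted_signed_star[OF H p])
  have mu0: "0 \<le> \<mu>" using l0 by (simp add: mu)
  have "s * (Y / 2) \<le> s * (Y - (edge_signal p * t) ^ t)" using s by (intro mult_left_mono half) auto
  also have "\<dots> \<le> 2 * real t ^ t * \<mu>"
    unfolding s_def Y_def mu by (rule planted_mean_signed_star_ge[OF H p n t(1)])
  also have "\<dots> \<le> 2 * real B ^ B * \<mu>" using Bt mu0 by (intro mult_right_mono) simp_all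
  finally have mu_ge: "s * Y / (4 * real B ^ B) \<le> \<mu>"
    using B by (simp add: field_simps)
  have BB: "real B ^ B > 0" using B by simp
  have mu_pos: "0 < \<mu>" using mu_ge s Y1 BB by (smt (verit) divide_pos_pos mult_pos_pos)
  have Q0: "measure_pmf.expectation Q f = 0"
    unfolding Q_def f_def by (rule expectation_gnp_signed_star[OF p t(1)])
  show pos: "0 < measure_pmf.expectation P f - measure_pmf.expectation Q f"
    using mu_pos by (simp add: Q0 \<mu>_def)
  have Q2: "measure_pmf.expectation Q (\<lambda>G. (f G)\<^sup>2) \<le> s\<^sup>2"
    unfolding s2 Q_def f_def by (rule expectation_gnp_signed_star[OF p t(1)])
  have sdQ: "sqrt (measure_pmf.variance Q f) \<le> s"
    using Q2 s by (intro real_le_lsqrt) (simp_all add: Q0)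
  have "measure_pmf.variance P f \<le> 2 * real t * real n ^ Suc t * (K ^ (2 * t) + Y\<^sup>2 / K\<^sup>2)"
    unfolding P_def f_def Y_def by (rule variance_planted_signed_star_le[OF H p n t(1) K1])
  also have "\<dots> \<le> 2 * real B * s\<^sup>2 * (Y\<^sup>2 / K\<^sup>2 + Y\<^sup>2 / K\<^sup>2)"
  proof -
    have "K ^ (2 * t) \<le> K ^ (2 * B)" using K1 t by (intro power_increasing) auto
    moreover have "Y\<^sup>2 = K ^ (2 * B) * K\<^sup>2"
      unfolding KB[symmetric] by (simp only: power_mult[symmetric] power_add[symmetric]) (simp add: mult.commute)
    ultimately have "K ^ (2 * t) \<le> Y\<^sup>2 / K\<^sup>2" using K1 by simp
    then show ?thesis using t K1 unfolding s2 by (intro mult_mono add_mono) auto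
  qed
  also have "\<dots> = 4 * real B * (s * Y / K)\<^sup>2" by (simp add: power_mult_distrib power_divide)
  also have "\<dots> \<le> (2 * real B * (s * Y / K))\<^sup>2"
  proof -
    have "4 * real B \<le> (2 * real B)\<^sup>2" using B by (simp add: power2_eq_square)
    then show ?thesis unfolding power_mult_distrib[of "2 * real B"] by (intro mult_right_mono) auto
  qed
  finally have sdP: "sqrt (measure_pmf.variance P f) \<le> 2 * real B * (s * Y / K)"
    using s Y1 K1 by (intro real_le_lsqrt) auto
  have "s * 1 \<le> s * (Y / K)" using s KY K1 by (intro mult_left_mono) auto
  also have "1 * (s * (Y / K)) \<le> 2 * real B * (s * (Y / K))"
    using B s Y1 K1 by (intro mult_right_mono) auto
  finally have "sqrt (measure_pmf.variance Q f) \<le> 2 * real B * (s * Y / K)" using sdQ by simp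
  with sdP have "max (sqrt (measure_pmf.variance P f)) (sqrt (measure_pmf.variance Q f)) \<le> 2 * real B * (s * Y / K)" by simp
  then have "max (sqrt (measure_pmf.variance P f)) (sqrt (measure_pmf.variance Q f)) / \<mu> \<le> 2 * real B * (s * Y / K) / (s * Y / (4 * real B ^ B))"
    using mu_ge s Y1 B K1 by (intro frac_le) auto
  also have "\<dots> = 8 * real B * real B ^ B * (1 / K)" using s Y1 B by (simp add: field_simps)
  also have "1 / K = Y powr (- (1 / Suc B))" unfolding K_def by (rule powr_minus_divide[symmetric])
  finally show "max (sqrt (measure_pmf.variance P f)) (sqrt (measure_pmf.variance Q f))
       / \<bar>measure_pmf.expectation P f - measure_pmf.expectation Q f\<bar>
       \<le> 8 * real B * real B ^ B * star_moment n p H t powr (- (1 / Suc B))"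
    using mu_pos by (simp add: Q0 Y_def flip: \<mu>_def)
  let ?q = "measure_pmf.expectation Q (\<lambda>G. (f G)\<^sup>2)"
  let ?St = "{S. S \<subseteq> pairs {1..n} \<and> graph_iso (\<Union>S, S) (star t)}"
  have q: "?q = real (card ?St)"
    unfolding Q_def f_def by (rule expectation_gnp_signed_star[OF p t(1)])
  \<comment> \<open>If there were no stars to count, the statistic would vanish identically, contradicting its positive
    planted mean.\<close>
  have "card ?St \<noteq> 0"
  proof
    have "finite ?St" by (rule finite_subset[of _ "Pow (pairs {1..n})"]) (use finite_pairs in auto)
    moreover assume "card ?St = 0"
    ultimately have "?St = {}" by (simp only: card_0_eq)
    then have "f = (\<lambda>_. 0)" unfolding f_def signed_count_def by (simp only: sum.empty)
    then show False using mu_pos by (simp add: \<mu>_def)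
  qed
  then have "?q > 0" unfolding q by simp
  then have q_pos: "sqrt ?q > 0" by (simp only: real_sqrt_gt_0_iff)
  have q_le: "sqrt ?q \<le> s" using Q2 s by (intro real_le_lsqrt) simp_all
  have "Y / (4 * real B ^ B) = (s * Y / (4 * real B ^ B)) / s" using s by simp
  also have "\<dots> \<le> \<mu> / sqrt ?q" using mu_ge mu0 q_pos q_le by (intro frac_le)
  also have "\<dots> = adv n p H f" by (simp add: adv_def \<mu>_def P_def Q_def)
  finally show "star_moment n p H t / (4 * real B ^ B) \<le> adv n p H f" by (simp only: Y_def)
qed

section \<open>The dominant star\<close>

lemma eventually_edge_signal_bounded:
  assumes "liminf (\<lambda>n. ereal (p n)) > 0"
  shows "\<exists>\<Lambda>\<ge>1. eventually (\<lambda>n. edge_signal (p n) \<le> \<Lambda>) sequentially"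
proof -
  obtain q :: real where q: "0 < ereal q" "ereal q < liminf (\<lambda>n. ereal (p n))"
    using ereal_dense2[OF assms] by auto
  have "eventually (\<lambda>n. ereal q < ereal (p n)) sequentially"
    using q(2) by (rule less_LiminfD)
  then have "eventually (\<lambda>n. edge_signal (p n) \<le> max 1 (sqrt (1 / q))) sequentially"
  proof eventually_elim
    case (elim n)
    then have "q < p n" "0 < q" using q by auto
    then have "(1 - p n) / p n \<le> 1 / q" by (intro frac_le) auto
    then have "edge_signal (p n) \<le> sqrt (1 / q)" unfolding edge_signal_def by (rule real_sqrt_le_mono)
    then show ?case by simp
  qed
  then show ?thesis by (intro exI[of _ "max 1 (sqrt (1 / q))"]) auto
qed

text \<open>
  Contrapositive of \<open>low_degree_energy_le\<close>: if the largest star moment stayed below \<open>Z\<close>, the advantage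
  would stay below a constant depending on \<open>Z\<close>.
\<close>

lemma dominant_star_moment_at_top:
  fixes H :: "nat \<Rightarrow> 'v sgraph"
  assumes H: "\<And>n. simple_graph (H n)" "\<And>n. card (verts (H n)) \<le> n"
    and D: "\<And>n. D n \<le> B" "1 \<le> B" and p: "\<And>n. 0 < p n \<and> p n < 1"
    and \<Lambda>: "1 \<le> \<Lambda>" "eventually (\<lambda>n. edge_signal (p n) \<le> \<Lambda>) sequentially"
    and adv: "(\<lambda>n. adv_upto n (p n) (H n) (D n)) \<longlonglongrightarrow> \<infinity>"
    and t: "\<And>n s. 1 \<le> s \<Longrightarrow> s \<le> D n \<Longrightarrow> star_moment n (p n) (H n) s \<le> star_moment n (p n) (H n) (t n)"
  shows "filterlim (\<lambda>n. star_moment n (p n) (H n) (t n)) at_top sequentially"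
  unfolding filterlim_at_top
proof
  fix Z :: real
  define M where "M = max Z 1"
  define C where "C = ((\<Lambda> * M) ^ B * real (2 * B) ^ (2 * B))\<^sup>2 * (2 ^ 2 ^ (2 * B) * real (2 * B + 1))"
  have "eventually (\<lambda>n. ereal (sqrt C) < adv_upto n (p n) (H n) (D n)) sequentially"
    using adv unfolding tendsto_PInfty by blast
  with \<Lambda>(2) eventually_gt_at_top[of "0::nat"]
  show "eventually (\<lambda>n. Z \<le> star_moment n (p n) (H n) (t n)) sequentially"
  proof eventually_elim
    case (elim n)
    show ?case
    proof (rule ccontr)
      assume "\<not> ?case"
      then have le: "star_moment n (p n) (H n) s \<le> M" if "1 \<le> s" "s \<le> D n" for s
        using t[OF that] by (simp add: M_def)
      have "low_degree_energy n (p n) (H n) (D n) \<le> C"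
        unfolding C_def using elim p \<Lambda> D le
        by (intro low_degree_energy_le H) (auto simp: M_def)
      then have "ereal (sqrt (low_degree_energy n (p n) (H n) (D n))) \<le> ereal (sqrt C)" by simp
      moreover have "adv_upto n (p n) (H n) (D n) \<le> ereal (sqrt (low_degree_energy n (p n) (H n) (D n)))"
        using p H by (intro adv_upto_le) (auto simp: simple_graph_def)
      ultimately show False using elim(1,3) by (meson leD order_trans)
    qed
  qed
qed

theorem theorem2p4:
  fixes H :: "nat \<Rightarrow> 'v sgraph"
    and D :: "nat \<Rightarrow> nat"
    and p :: "nat \<Rightarrow> real"
  assumes "\<And>n. simple_graph (H n)"
    and "\<And>n. card (verts (H n)) \<le> n"
    and "\<And>n. D n \<ge> 1"
    and "bdd_above (range D)"
    and "\<And>n. 0 < p n \<and> p n < 1"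
    and "liminf (\<lambda>n. ereal (p n)) > 0"
  defines "Q \<equiv> \<lambda>n. gnp n (p n)"
    and "P \<equiv> \<lambda>n. planted n (p n) (H n)"
  shows
    "(limsup (\<lambda>n. adv_upto n (p n) (H n) (D n)) < \<infinity> \<longrightarrow>
        \<not> (\<exists>F. (\<forall>n. F n \<in> polys_upto n (D n)) \<and>
               strongly_separates P Q (\<lambda>n. poly_eval (F n)))) \<and>
     ((\<lambda>n. adv_upto n (p n) (H n) (D n)) \<longlonglongrightarrow> \<infinity> \<longrightarrow>
        (\<exists>t. (\<forall>n. 1 \<le> t n \<and> t n \<le> D n) \<and>
             strongly_separates P Q (\<lambda>n. signed_count n (p n) (star (t n))) \<and>
             (\<lambda>n. ereal (adv n (p n) (H n) (signed_count n (p n) (star (t n))))) \<longlonglongrightarrow> \<infinity>))"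
proof (intro conjI impI)
  assume bdd: "limsup (\<lambda>n. adv_upto n (p n) (H n) (D n)) < \<infinity>"
  have V: "finite (verts (H n))" for n using assms(1)[of n] by (simp add: simple_graph_def)
  show "\<not> (\<exists>F. (\<forall>n. F n \<in> polys_upto n (D n)) \<and> strongly_separates P Q (\<lambda>n. poly_eval (F n)))"
    unfolding P_def Q_def using bounded_advantage_excludes_separation[OF V assms(2,5) bdd] by blast
next
  assume adv: "(\<lambda>n. adv_upto n (p n) (H n) (D n)) \<longlonglongrightarrow> \<infinity>"
  obtain B where B: "\<And>n. D n \<le> B" using assms(4) by (auto simp: bdd_above_def)
  have B1: "1 \<le> B" using B[of 0] assms(3)[of 0] by linarith
  obtain \<Lambda> where \<Lambda>: "1 \<le> \<Lambda>" "eventually (\<lambda>n. edge_signal (p n) \<le> \<Lambda>) sequentially"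
    using eventually_edge_signal_bounded[OF assms(6)] by blast
  let ?Y = "\<lambda>n. star_moment n (p n) (H n)"
  have "\<exists>t. (1 \<le> t \<and> t \<le> D n) \<and> (\<forall>s. 1 \<le> s \<longrightarrow> s \<le> D n \<longrightarrow> ?Y n s \<le> ?Y n t)" for n
  proof -
    have fin: "finite (?Y n ` {1..D n})" and ne: "?Y n ` {1..D n} \<noteq> {}" using assms(3)[of n] by auto
    obtain t where t: "t \<in> {1..D n}" "Max (?Y n ` {1..D n}) = ?Y n t"
      using Max_in[OF fin ne] by auto
    have "?Y n s \<le> ?Y n t" if "1 \<le> s" "s \<le> D n" for s
      unfolding t(2)[symmetric] using fin that by (intro Max_ge) auto
    then show ?thesis using t(1) by (intro exI[of _ t]) auto
  qed
  then obtain t where t: "\<And>n. 1 \<le> t n \<and> t n \<le> D n"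
      and tmax: "\<And>n s. 1 \<le> s \<Longrightarrow> s \<le> D n \<Longrightarrow> ?Y n s \<le> ?Y n (t n)"
    by metis
  have lim: "filterlim (\<lambda>n. ?Y n (t n)) at_top sequentially"
    by (rule dominant_star_moment_at_top[OF assms(1,2) B B1 assms(5) \<Lambda> adv tmax])
  let ?f = "\<lambda>n. signed_count n (p n) (star (t n))"
  have good: "eventually (\<lambda>n. n > 0 \<and> edge_signal (p n) \<le> \<Lambda> \<and> 1 \<le> ?Y n (t n) \<and> 2 * (\<Lambda> * B) ^ B \<le> ?Y n (t n)) sequentially"
    using lim[unfolded filterlim_at_top] \<Lambda>(2) eventually_gt_at_top[of "0::nat"] by (intro eventually_conj) auto
  have bounds: "0 < measure_pmf.expectation (P n) (?f n) - measure_pmf.expectation (Q n) (?f n)"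
      "max (sqrt (measure_pmf.variance (P n) (?f n))) (sqrt (measure_pmf.variance (Q n) (?f n)))
       / \<bar>measure_pmf.expectation (P n) (?f n) - measure_pmf.expectation (Q n) (?f n)\<bar>
       \<le> 8 * real B * real B ^ B * ?Y n (t n) powr (- (1 / Suc B))"
      "?Y n (t n) / (4 * real B ^ B) \<le> adv n (p n) (H n) (?f n)"
    if g: "n > 0 \<and> edge_signal (p n) \<le> \<Lambda> \<and> 1 \<le> ?Y n (t n) \<and> 2 * (\<Lambda> * B) ^ B \<le> ?Y n (t n)" for n
  proof -
    have tB: "1 \<le> t n" "t n \<le> B" using t[of n] B[of n] by auto
    have pn: "0 < p n" "p n < 1" using assms(5) by auto
    have g': "n > 0" "edge_signal (p n) \<le> \<Lambda>" "1 \<le> ?Y n (t n)" "2 * (\<Lambda> * B) ^ B \<le> ?Y n (t n)" using g by auto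
    note r = star_separation_ratio_le[OF assms(1,2) pn g'(1) tB g'(2) \<Lambda>(1) g'(3,4)]
    show "0 < measure_pmf.expectation (P n) (?f n) - measure_pmf.expectation (Q n) (?f n)"
      "max (sqrt (measure_pmf.variance (P n) (?f n))) (sqrt (measure_pmf.variance (Q n) (?f n)))
       / \<bar>measure_pmf.expectation (P n) (?f n) - measure_pmf.expectation (Q n) (?f n)\<bar>
       \<le> 8 * real B * real B ^ B * ?Y n (t n) powr (- (1 / Suc B))"
      "?Y n (t n) / (4 * real B ^ B) \<le> adv n (p n) (H n) (?f n)"
      unfolding P_def Q_def by (rule r)+
  qed
  have "((\<lambda>n. ?Y n (t n) powr (- (1 / Suc B))) \<longlongrightarrow> 0) sequentially"
    by (rule tendsto_neg_powr[OF _ lim]) simp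
  then have zero: "((\<lambda>n. 8 * real B * real B ^ B * ?Y n (t n) powr (- (1 / Suc B))) \<longlongrightarrow> 0) sequentially"
    by (rule tendsto_mult_right_zero)
  have sep: "strongly_separates P Q ?f"
    unfolding strongly_separates_def negligible_wrt_def
  proof (intro conjI)
    show "eventually (\<lambda>n. \<bar>measure_pmf.expectation (P n) (?f n) - measure_pmf.expectation (Q n) (?f n)\<bar> \<noteq> 0) sequentially"
      using good by (rule eventually_mono) (use bounds(1) in fastforce)
    show "(\<lambda>n. max (sqrt (measure_pmf.variance (P n) (?f n))) (sqrt (measure_pmf.variance (Q n) (?f n)))
       / \<bar>measure_pmf.expectation (P n) (?f n) - measure_pmf.expectation (Q n) (?f n)\<bar>) \<longlonglongrightarrow> 0"
    proof (rule tendsto_sandwich[OF _ _ tendsto_const zero])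
      show "eventually (\<lambda>n. 0 \<le> max (sqrt (measure_pmf.variance (P n) (?f n))) (sqrt (measure_pmf.variance (Q n) (?f n)))
         / \<bar>measure_pmf.expectation (P n) (?f n) - measure_pmf.expectation (Q n) (?f n)\<bar>) sequentially"
        by (intro always_eventually allI divide_nonneg_nonneg) (auto simp: le_max_iff_disj intro!: integral_nonneg_AE)
      show "eventually (\<lambda>n. max (sqrt (measure_pmf.variance (P n) (?f n))) (sqrt (measure_pmf.variance (Q n) (?f n)))
         / \<bar>measure_pmf.expectation (P n) (?f n) - measure_pmf.expectation (Q n) (?f n)\<bar>
         \<le> 8 * real B * real B ^ B * ?Y n (t n) powr (- (1 / Suc B))) sequentially"
        using good by (rule eventually_mono) (rule bounds(2))
    qed
  qed
  have "(\<lambda>n. ereal (adv n (p n) (H n) (?f n))) \<longlonglongrightarrow> \<infinity>"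
    unfolding tendsto_PInfty
  proof
    fix r :: real
    have "eventually (\<lambda>n. (\<bar>r\<bar> + 1) * (4 * real B ^ B) \<le> ?Y n (t n)) sequentially"
      using lim[unfolded filterlim_at_top] by blast
    with good show "eventually (\<lambda>n. ereal r < ereal (adv n (p n) (H n) (?f n))) sequentially"
    proof eventually_elim
      case (elim n)
      have "\<bar>r\<bar> + 1 \<le> ?Y n (t n) / (4 * real B ^ B)" using elim(2) B1 by (subst pos_le_divide_eq) auto
      also have "\<dots> \<le> adv n (p n) (H n) (?f n)" by (rule bounds(3)[OF elim(1)])
      finally show ?case by simp
    qed
  qed
  then show "\<exists>t. (\<forall>n. 1 \<le> t n \<and> t n \<le> D n) \<and>
             strongly_separates P Q (\<lambda>n. signed_count n (p n) (star (t n))) \<and>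
             (\<lambda>n. ereal (adv n (p n) (H n) (signed_count n (p n) (star (t n))))) \<longlonglongrightarrow> \<infinity>"
    using t sep by blast
qed

end
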